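(* Let $k$ be a field, $(C,Q)$ a Rota-Baxter coalgebra of weight $0$ over $k$, and $(M,Q,T)$ a Rota-Baxter paired $C$-comodule of weight $0$. Define $\widetilde{\rho}:M\to C\otimes M$ by $$\widetilde{\rho}(m)=Q(m_{(-1)})\otimes m_{(0)}+m_{(-1)}\otimes T(m_{(0)})$$ for $m\in M$. Then $(M,\widetilde{\rho})$ is a left $\widetilde{C}$-pre-Lie comodule, where $\widetilde{C}=(C,\widetilde{\Delta})$ is the pre-Lie coalgebra with $\widetilde{\Delta}(c)=Q(c_1)\otimes c_2-Q(c_2)\otimes c_1$.
   Context: All spaces, maps and tensor products are over $k$. Sweedler notation: $\Delta(c)=c_1\otimes c_2$; left coaction $\rho(m)=m_{(-1)}\otimes m_{(0)}\in C\otimes M$. A coalgebra $(C,\Delta)$ with a linear map $Q:C\to C$ is a Rota-Baxter coalgebra of weight $\lambda$ if $(Q\otimes Q)\Delta=(Q\otimes \mathrm{id})\Delta Q+(\mathrm{id}\otimes Q)\Delta Q+\lambda\Delta Q$. For a left $C$-comodule $M$ and linear maps $Q:C\to C$, $T:M\to M$, $(M,Q,T)$ is a Rota-Baxter paired (left) $C$-comodule of weight $\lambda$ if $(Q\otimes T)\rho=(Q\otimes \mathrm{id})\rho T+(\mathrm{id}\otimes T)\rho T+\lambda\rho T$. A pre-Lie coalgebra is a space $C$ with a linear map $\Delta:C\to C\otimes C$ such that $\Delta_C-\Phi_{(12)}\Delta_C=0$, where $\Delta_C=(\Delta\otimes\mathrm{id})\Delta-(\mathrm{id}\otimes\Delta)\Delta$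 and $\Phi_{(12)}(a\otimes b\otimes c)=b\otimes a\otimes c$. A left pre-Lie comodule over a pre-Lie coalgebra $(C,\Delta)$ is a space $M$ with a linear map $\rho:M\to C\otimes M$ such that $\rho_M-(\tau\otimes\mathrm{id})\rho_M=0$, where $\rho_M=(\mathrm{id}\otimes\rho)\rho-(\Delta\otimes\mathrm{id})\rho$ and $\tau(c\otimes d)=d\otimes c$. It is known that, for $(C,Q)$ a Rota-Baxter coalgebra of weight $0$, the $\widetilde{C}$ in the statement is a pre-Lie coalgebra. *)

theory Defs
  imports "Jordan_Normal_Form.Missing_VectorSpace" "HOL-Algebra.AbelCoset"
begin

section \<open>Tensor products of vector spaces\<close>

text \<open>
  Vector spaces over a field \<open>K\<close> are those of the locale \<open>vectorspace\<close>, linear maps those of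
  \<open>linear_map\<close>. The tensor product \<open>V \<otimes> W\<close> is the free vector space on
  \<open>carrier V \<times> carrier W\<close> modulo the span of the bilinearity relations.
  The multiplicative fields of the module record carry no information and are left undefined.
\<close>

definition free_space :: "('k, 'r) ring_scheme \<Rightarrow> 'b set \<Rightarrow> ('k, 'b \<Rightarrow> 'k) module" where
  "free_space K B =
    \<lparr>carrier = {p \<in> B \<rightarrow>\<^sub>E carrier K. finite {b \<in> B. p b \<noteq> \<zero>\<^bsub>K\<^esub>}},
     mult = undefined, one = undefined,
     zero = (\<lambda>b\<in>B. \<zero>\<^bsub>K\<^esub>),
     add = (\<lambda>p q. \<lambda>b\<in>B. p b \<oplus>\<^bsub>K\<^esub> q b),
     smult = (\<lambda>a p. \<lambda>b\<in>B. a \<otimes>\<^bsub>K\<^esub> p b)\<rparr>"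

definition free_gen :: "('k, 'r) ring_scheme \<Rightarrow> 'b set \<Rightarrow> 'b \<Rightarrow> 'b \<Rightarrow> 'k" where
  "free_gen K B b = (\<lambda>x\<in>B. if x = b then \<one>\<^bsub>K\<^esub> else \<zero>\<^bsub>K\<^esub>)"

definition tensor_relators ::
  "('k, 'r) ring_scheme \<Rightarrow> ('k, 'v, 'x) module_scheme \<Rightarrow> ('k, 'w, 'y) module_scheme
    \<Rightarrow> ('v \<times> 'w \<Rightarrow> 'k) set" where
  "tensor_relators K V W =
    (let F = free_space K (carrier V \<times> carrier W);
         e = (\<lambda>v w. free_gen K (carrier V \<times> carrier W) (v, w))
     in {e (v \<oplus>\<^bsub>V\<^esub> v') w \<ominus>\<^bsub>F\<^esub> (e v w \<oplus>\<^bsub>F\<^esub> e v' w) | v v' w.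
           v \<in> carrier V \<and> v' \<in> carrier V \<and> w \<in> carrier W}
      \<union> {e v (w \<oplus>\<^bsub>W\<^esub> w') \<ominus>\<^bsub>F\<^esub> (e v w \<oplus>\<^bsub>F\<^esub> e v w') | v w w'.
           v \<in> carrier V \<and> w \<in> carrier W \<and> w' \<in> carrier W}
      \<union> {e (a \<odot>\<^bsub>V\<^esub> v) w \<ominus>\<^bsub>F\<^esub> (a \<odot>\<^bsub>F\<^esub> e v w) | a v w.
           a \<in> carrier K \<and> v \<in> carrier V \<and> w \<in> carrier W}
      \<union> {e v (a \<odot>\<^bsub>W\<^esub> w) \<ominus>\<^bsub>F\<^esub> (a \<odot>\<^bsub>F\<^esub> e v w) | a v w.
           a \<in> carrier K \<and> v \<in> carrier V \<and> w \<in> carrier W})"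

definition tensor_null ::
  "('k, 'r) ring_scheme \<Rightarrow> ('k, 'v, 'x) module_scheme \<Rightarrow> ('k, 'w, 'y) module_scheme
    \<Rightarrow> ('v \<times> 'w \<Rightarrow> 'k) set" where
  "tensor_null K V W =
    module.span K (free_space K (carrier V \<times> carrier W)) (tensor_relators K V W)"

definition tensor ::
  "('k, 'r) ring_scheme \<Rightarrow> ('k, 'v, 'x) module_scheme \<Rightarrow> ('k, 'w, 'y) module_scheme
    \<Rightarrow> ('k, ('v \<times> 'w \<Rightarrow> 'k) set) module" where
  "tensor K V W =
    (let F = free_space K (carrier V \<times> carrier W); N = tensor_null K V W
     in \<lparr>carrier = a_rcosets\<^bsub>F\<^esub> N,
         mult = undefined, one = undefined,
         zero = N,
         add = set_add F,
         smult = (\<lambda>a X. \<Union>p\<in>X. N +>\<^bsub>F\<^esub> (a \<odot>\<^bsub>F\<^esub> p))\<rparr>)"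

definition pure_tensor ::
  "('k, 'r) ring_scheme \<Rightarrow> ('k, 'v, 'x) module_scheme \<Rightarrow> ('k, 'w, 'y) module_scheme
    \<Rightarrow> 'v \<Rightarrow> 'w \<Rightarrow> ('v \<times> 'w \<Rightarrow> 'k) set" where
  "pure_tensor K V W v w =
    tensor_null K V W +>\<^bsub>free_space K (carrier V \<times> carrier W)\<^esub>
      free_gen K (carrier V \<times> carrier W) (v, w)"

text \<open>
  The linear map \<open>V \<otimes> W \<rightarrow> P\<close> induced by a bilinear map \<open>\<beta> : V \<times> W \<rightarrow> P\<close>: the class of
  \<open>\<Sum> p(v, w) (v, w)\<close> is sent to \<open>\<Sum> p(v, w) \<beta>(v, w)\<close>, which for bilinear \<open>\<beta>\<close> is the
  same for all representatives \<open>p\<close> (for other \<open>\<beta>\<close> the value is arbitrary).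
\<close>

definition tensor_lift ::
  "('k, 'r) ring_scheme \<Rightarrow> ('k, 'v, 'x) module_scheme \<Rightarrow> ('k, 'w, 'y) module_scheme
    \<Rightarrow> ('k, 'p, 'z) module_scheme \<Rightarrow> ('v \<Rightarrow> 'w \<Rightarrow> 'p) \<Rightarrow> ('v \<times> 'w \<Rightarrow> 'k) set \<Rightarrow> 'p" where
  "tensor_lift K V W P \<beta> X =
    the_elem ((\<lambda>p. \<Oplus>\<^bsub>P\<^esub>z\<in>{z \<in> carrier V \<times> carrier W. p z \<noteq> \<zero>\<^bsub>K\<^esub>}.
                       p z \<odot>\<^bsub>P\<^esub> \<beta> (fst z) (snd z)) ` X)"

text \<open>\<open>f \<otimes> g : V \<otimes> W \<rightarrow> V' \<otimes> W'\<close>\<close>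

definition tensor_map ::
  "('k, 'r) ring_scheme \<Rightarrow> ('k, 'v, 'x) module_scheme \<Rightarrow> ('k, 'w, 'y) module_scheme
    \<Rightarrow> ('k, 'v1, 'x1) module_scheme \<Rightarrow> ('k, 'w1, 'y1) module_scheme
    \<Rightarrow> ('v \<Rightarrow> 'v1) \<Rightarrow> ('w \<Rightarrow> 'w1)
    \<Rightarrow> ('v \<times> 'w \<Rightarrow> 'k) set \<Rightarrow> ('v1 \<times> 'w1 \<Rightarrow> 'k) set" where
  "tensor_map K V W V' W' f g =
    tensor_lift K V W (tensor K V' W') (\<lambda>v w. pure_tensor K V' W' (f v) (g w))"

text \<open>\<open>\<tau> : V \<otimes> W \<rightarrow> W \<otimes> V\<close>\<close>

definition tensor_swap ::
  "('k, 'r) ring_scheme \<Rightarrow> ('k, 'v, 'x) module_scheme \<Rightarrow> ('k, 'w, 'y) module_scheme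
    \<Rightarrow> ('v \<times> 'w \<Rightarrow> 'k) set \<Rightarrow> ('w \<times> 'v \<Rightarrow> 'k) set" where
  "tensor_swap K V W = tensor_lift K V W (tensor K W V) (\<lambda>v w. pure_tensor K W V w v)"

text \<open>
  The canonical map \<open>U \<otimes> (V \<otimes> W) \<rightarrow> (U \<otimes> V) \<otimes> W\<close>, which is usually suppressed. All
  identities between threefold tensors below are stated in \<open>(U \<otimes> V) \<otimes> W\<close>.
\<close>

definition tensor_assoc ::
  "('k, 'r) ring_scheme \<Rightarrow> ('k, 'u, 'x) module_scheme \<Rightarrow> ('k, 'v, 'y) module_scheme
    \<Rightarrow> ('k, 'w, 'z) module_scheme
    \<Rightarrow> ('u \<times> ('v \<times> 'w \<Rightarrow> 'k) set \<Rightarrow> 'k) set \<Rightarrow> (('u \<times> 'v \<Rightarrow> 'k) set \<times> 'w \<Rightarrow> 'k) set" where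
  "tensor_assoc K U V W =
    tensor_lift K U (tensor K V W) (tensor K (tensor K U V) W)
      (\<lambda>u. tensor_lift K V W (tensor K (tensor K U V) W)
        (\<lambda>v w. pure_tensor K (tensor K U V) W (pure_tensor K U V u v) w))"


section \<open>Rota-Baxter coalgebras and Rota-Baxter paired comodules\<close>

text \<open>
  A coalgebra is given by its coassociative coproduct alone; a counit is not required, and
  correspondingly comodules need not be counital.
\<close>

locale coalgebra =
  fixes K (structure) and C (structure) and \<Delta>
  assumes coproduct_linear: "linear_map K C (tensor K C C) \<Delta>"
    and coassoc: "\<And>c. c \<in> carrier C \<Longrightarrow>
      tensor_map K C C (tensor K C C) C \<Delta> id (\<Delta> c) =
      tensor_assoc K C C C (tensor_map K C C C (tensor K C C) id \<Delta> (\<Delta> c))"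

locale left_comodule = coalgebra K C \<Delta>
  for K (structure) and C (structure) and \<Delta> +
  fixes M (structure) and \<rho>
  assumes coaction_linear: "linear_map K M (tensor K C M) \<rho>"
    and coaction_coassoc: "\<And>m. m \<in> carrier M \<Longrightarrow>
      tensor_map K C M (tensor K C C) M \<Delta> id (\<rho> m) =
      tensor_assoc K C C M (tensor_map K C M C (tensor K C M) id \<rho> (\<rho> m))"

locale rota_baxter_coalgebra = coalgebra K C \<Delta>
  for K (structure) and l and C (structure) and \<Delta> +
  fixes Q
  assumes weight_closed: "l \<in> carrier K"
    and operator_linear: "linear_map K C C Q"
    and rota_baxter: "\<And>c. c \<in> carrier C \<Longrightarrow>
      tensor_map K C C C C Q Q (\<Delta> c) =
        tensor_map K C C C C Q id (\<Delta> (Q c)) \<oplus>\<^bsub>tensor K C C\<^esub>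
        tensor_map K C C C C id Q (\<Delta> (Q c)) \<oplus>\<^bsub>tensor K C C\<^esub>
        l \<odot>\<^bsub>tensor K C C\<^esub> \<Delta> (Q c)"

locale rota_baxter_paired_comodule = left_comodule K C \<Delta> M \<rho>
  for K (structure) and l and C (structure) and \<Delta> and M (structure) and \<rho> +
  fixes Q and T
  assumes weight_closed: "l \<in> carrier K"
    and operator_linear: "linear_map K C C Q"
    and paired_operator_linear: "linear_map K M M T"
    and rota_baxter_paired: "\<And>m. m \<in> carrier M \<Longrightarrow>
      tensor_map K C M C M Q T (\<rho> m) =
        tensor_map K C M C M Q id (\<rho> (T m)) \<oplus>\<^bsub>tensor K C M\<^esub>
        tensor_map K C M C M id T (\<rho> (T m)) \<oplus>\<^bsub>tensor K C M\<^esub>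
        l \<odot>\<^bsub>tensor K C M\<^esub> \<rho> (T m)"


section \<open>Pre-Lie coalgebras and pre-Lie comodules\<close>

text \<open>\<open>\<Delta>\<^sub>C = (\<Delta> \<otimes> id) \<Delta> - (id \<otimes> \<Delta>) \<Delta>\<close>\<close>

definition coassociator where
  "coassociator K C \<Delta> c =
    tensor_map K C C (tensor K C C) C \<Delta> id (\<Delta> c)
    \<ominus>\<^bsub>tensor K (tensor K C C) C\<^esub>
    tensor_assoc K C C C (tensor_map K C C C (tensor K C C) id \<Delta> (\<Delta> c))"

text \<open>\<open>\<rho>\<^sub>M = (id \<otimes> \<rho>) \<rho> - (\<Delta> \<otimes> id) \<rho>\<close>\<close>

definition comodule_associator where
  "comodule_associator K C \<Delta> M \<rho> m =
    tensor_assoc K C C M (tensor_map K C M C (tensor K C M) id \<rho> (\<rho> m))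
    \<ominus>\<^bsub>tensor K (tensor K C C) M\<^esub>
    tensor_map K C M (tensor K C C) M \<Delta> id (\<rho> m)"

text \<open>On \<open>(C \<otimes> C) \<otimes> C\<close> the permutation \<open>a \<otimes> b \<otimes> c \<mapsto> b \<otimes> a \<otimes> c\<close> is \<open>\<tau> \<otimes> id\<close>.\<close>

locale pre_lie_coalgebra =
  fixes K (structure) and C (structure) and \<Delta>
  assumes coproduct_linear: "linear_map K C (tensor K C C) \<Delta>"
    and pre_lie: "\<And>c. c \<in> carrier C \<Longrightarrow>
      coassociator K C \<Delta> c \<ominus>\<^bsub>tensor K (tensor K C C) C\<^esub>
      tensor_map K (tensor K C C) C (tensor K C C) C (tensor_swap K C C) id
        (coassociator K C \<Delta> c)
      = \<zero>\<^bsub>tensor K (tensor K C C) C\<^esub>"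

locale left_pre_lie_comodule = pre_lie_coalgebra K C \<Delta>
  for K (structure) and C (structure) and \<Delta> +
  fixes M (structure) and \<rho>
  assumes coaction_linear: "linear_map K M (tensor K C M) \<rho>"
    and pre_lie_comodule: "\<And>m. m \<in> carrier M \<Longrightarrow>
      comodule_associator K C \<Delta> M \<rho> m \<ominus>\<^bsub>tensor K (tensor K C C) M\<^esub>
      tensor_map K (tensor K C C) M (tensor K C C) M (tensor_swap K C C) id
        (comodule_associator K C \<Delta> M \<rho> m)
      = \<zero>\<^bsub>tensor K (tensor K C C) M\<^esub>"

text \<open>
  In Sweedler notation, \<open>\<Delta>~(c) = Q(c\<^sub>1) \<otimes> c\<^sub>2 - Q(c\<^sub>2) \<otimes> c\<^sub>1\<close> and
  \<open>\<rho>~(m) = Q(m\<^sub>-\<^sub>1) \<otimes> m\<^sub>0 + m\<^sub>-\<^sub>1 \<otimes> T(m\<^sub>0)\<close>.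
\<close>

definition tilde_coproduct where
  "tilde_coproduct K C \<Delta> Q c =
    tensor_lift K C C (tensor K C C)
      (\<lambda>c1 c2. pure_tensor K C C (Q c1) c2 \<ominus>\<^bsub>tensor K C C\<^esub> pure_tensor K C C (Q c2) c1) (\<Delta> c)"

definition tilde_coaction where
  "tilde_coaction K C M \<rho> Q T m =
    tensor_lift K C M (tensor K C M)
      (\<lambda>a n. pure_tensor K C M (Q a) n \<oplus>\<^bsub>tensor K C M\<^esub> pure_tensor K C M a (T n)) (\<rho> m)"

end

theory Submission
  imports Defs
begin

text \<open>
  Let \<open>A = 1 - \<tau>\<close> on \<open>C \<otimes> C\<close>, so that \<open>\<Delta>~ = (Q \<otimes> id) A \<Delta>\<close> and
  \<open>\<rho>~ = (Q \<otimes> id + id \<otimes> T) \<rho>\<close>; the pre-Lie conditions say that \<open>A \<otimes> id\<close> annihilates the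
  associators. Since \<open>A (Q \<otimes> id) A = A (Q \<otimes> id + id \<otimes> Q)\<close>, the Rota-Baxter identity gives
  \<open>A \<Delta>~ Q = A (Q \<otimes> Q) \<Delta>\<close>. With \<open>X = (\<Delta> \<otimes> id) \<rho> = (id \<otimes> \<rho>) \<rho>\<close>, both \<open>(id \<otimes> \<rho>~) \<rho>~\<close> and
  \<open>(\<Delta>~ \<otimes> id) \<rho>~\<close> therefore agree with \<open>(Q \<otimes> Q \<otimes> id) X + ((Q \<otimes> id + id \<otimes> Q) \<otimes> T) X\<close> after
  applying \<open>A \<otimes> id\<close>. For the coalgebra itself \<open>Q \<otimes> Q \<otimes> id\<close> factors out in the same way, and what
  is left is an identity between permutations of \<open>c\<^sub>1 \<otimes> c\<^sub>2 \<otimes> c\<^sub>3\<close>.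
\<close>

section \<open>Free modules and quotient modules\<close>

text \<open>The identity \<open>A (Q \<otimes> id) A = A (Q \<otimes> id + id \<otimes> Q)\<close>
  holds because \<open>(Q \<otimes> id) \<tau> = \<tau> (id \<otimes> Q)\<close> and
  \<open>A \<tau> = - A\<close>. The axioms speak only of the values \<open>\<Delta> c\<close> and
  \<open>\<rho> m\<close>, never of a single pure tensor, so a Sweedler computation cannot be
  carried out term by term. Identities valid for all tensors are therefore separated from the
  axioms, checked on pure tensors, and only then evaluated at \<open>\<Delta> c\<close> or
  \<open>\<rho> m\<close>. A second obstacle is that the Rota-Baxter identity determines
  \<open>\<Delta>~ Q\<close> only up to the kernel of \<open>A\<close>. It may be used in the first
  two slots only underneath \<open>A \<otimes> id\<close>, while the last slot can carry any linear
  map. On the coalgebra, \<open>Q \<otimes> Q \<otimes> id\<close> can be pulled out of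
  \<open>A \<otimes> id\<close> because it acts symmetrically on the first two slots. With
  \<open>u = A \<Delta> c\<close>, the remaining claim is that
  \<open>(\<Delta> \<otimes> id) u\<close> and
  \<open>(id \<otimes> A) (id \<otimes> \<Delta>) u\<close> agree after
  \<open>A \<otimes> id\<close>; coassociativity expresses both through one threefold tensor and its
  cyclic shifts.\<close>

lemma free_space_simps [simp]:
  "carrier (free_space K B) = {p \<in> B \<rightarrow>\<^sub>E carrier K. finite {b \<in> B. p b \<noteq> \<zero>\<^bsub>K\<^esub>}}"
  "\<zero>\<^bsub>free_space K B\<^esub> = (\<lambda>b\<in>B. \<zero>\<^bsub>K\<^esub>)"
  "p \<oplus>\<^bsub>free_space K B\<^esub> q = (\<lambda>b\<in>B. p b \<oplus>\<^bsub>K\<^esub> q b)"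
  "a \<odot>\<^bsub>free_space K B\<^esub> p = (\<lambda>b\<in>B. a \<otimes>\<^bsub>K\<^esub> p b)"
  by (simp_all add: free_space_def)

lemma mod_homI:
  assumes "module R V" "module R W"
    and "\<And>v. v \<in> carrier V \<Longrightarrow> f v \<in> carrier W"
    and "\<And>v v'. \<lbrakk>v \<in> carrier V; v' \<in> carrier V\<rbrakk> \<Longrightarrow> f (v \<oplus>\<^bsub>V\<^esub> v') = f v \<oplus>\<^bsub>W\<^esub> f v'"
    and "\<And>a v. \<lbrakk>a \<in> carrier R; v \<in> carrier V\<rbrakk> \<Longrightarrow> f (a \<odot>\<^bsub>V\<^esub> v) = a \<odot>\<^bsub>W\<^esub> f v"
  shows "mod_hom R V W f"
  using assms unfolding mod_hom_def mod_hom_axioms_def module_hom_def by blast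

lemma mod_homD:
  assumes "mod_hom R V W f"
  shows "module R V" "module R W"
    and "v \<in> carrier V \<Longrightarrow> f v \<in> carrier W"
    and "\<lbrakk>v \<in> carrier V; v' \<in> carrier V\<rbrakk> \<Longrightarrow> f (v \<oplus>\<^bsub>V\<^esub> v') = f v \<oplus>\<^bsub>W\<^esub> f v'"
    and "\<lbrakk>a \<in> carrier R; v \<in> carrier V\<rbrakk> \<Longrightarrow> f (a \<odot>\<^bsub>V\<^esub> v) = a \<odot>\<^bsub>W\<^esub> f v"
    and "f \<zero>\<^bsub>V\<^esub> = \<zero>\<^bsub>W\<^esub>"
    and "\<lbrakk>v \<in> carrier V; v' \<in> carrier V\<rbrakk> \<Longrightarrow> f (v \<ominus>\<^bsub>V\<^esub> v') = f v \<ominus>\<^bsub>W\<^esub> f v'"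
  using assms mod_hom.f0_is_0[OF assms] mod_hom.f_minus[OF assms]
  unfolding mod_hom_def mod_hom_axioms_def module_hom_def by blast+

context cring
begin

lemma free_space_add_closed:
  assumes "p \<in> carrier (free_space R B)" "q \<in> carrier (free_space R B)"
  shows "p \<oplus>\<^bsub>free_space R B\<^esub> q \<in> carrier (free_space R B)"
proof -
  have "finite ({b \<in> B. p b \<noteq> \<zero>} \<union> {b \<in> B. q b \<noteq> \<zero>})"
    using assms by simp
  moreover have "{b \<in> B. (\<lambda>b\<in>B. p b \<oplus> q b) b \<noteq> \<zero>} \<subseteq> {b \<in> B. p b \<noteq> \<zero>} \<union> {b \<in> B. q b \<noteq> \<zero>}"
    by auto
  ultimately have "finite {b \<in> B. (\<lambda>b\<in>B. p b \<oplus> q b) b \<noteq> \<zero>}"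
    using finite_subset by blast
  then show ?thesis
    using assms by (auto simp: PiE_mem)
qed

lemma free_space_smult_closed:
  assumes "a \<in> carrier R" "p \<in> carrier (free_space R B)"
  shows "a \<odot>\<^bsub>free_space R B\<^esub> p \<in> carrier (free_space R B)"
proof -
  have "{b \<in> B. (\<lambda>b\<in>B. a \<otimes> p b) b \<noteq> \<zero>} \<subseteq> {b \<in> B. p b \<noteq> \<zero>}"
    using assms by auto
  moreover have "finite {b \<in> B. p b \<noteq> \<zero>}"
    using assms by simp
  ultimately have "finite {b \<in> B. (\<lambda>b\<in>B. a \<otimes> p b) b \<noteq> \<zero>}"
    by (rule finite_subset)
  then show ?thesis
    using assms by (auto simp: PiE_mem)
qed

lemma free_space_eqI:
  assumes "p \<in> carrier (free_space R B)" "q \<in> carrier (free_space R B)"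
    and "\<And>b. b \<in> B \<Longrightarrow> p b = q b"
  shows "p = q"
  by (rule PiE_ext[of p B "\<lambda>_. carrier R" q]) (use assms in simp_all)

lemma free_space_mem: "\<lbrakk>p \<in> B \<rightarrow>\<^sub>E carrier R; b \<in> B\<rbrakk> \<Longrightarrow> p b \<in> carrier R"
  by (rule PiE_mem)

lemma free_space_zero_closed: "\<zero>\<^bsub>free_space R B\<^esub> \<in> carrier (free_space R B)"
  by simp

lemma free_space_module: "module R (free_space R B)"
proof (rule moduleI)
  show "abelian_group (free_space R B)"
  proof (rule abelian_groupI)
    fix x y
    assume xy: "x \<in> carrier (free_space R B)" "y \<in> carrier (free_space R B)"
    show "x \<oplus>\<^bsub>free_space R B\<^esub> y \<in> carrier (free_space R B)"
      using xy by (rule free_space_add_closed)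
    show "x \<oplus>\<^bsub>free_space R B\<^esub> y = y \<oplus>\<^bsub>free_space R B\<^esub> x"
      using xy by (auto intro!: restrict_ext a_comm simp: PiE_mem)
  next
    fix x y z
    assume "x \<in> carrier (free_space R B)" "y \<in> carrier (free_space R B)" 
      "z \<in> carrier (free_space R B)"
    then show "x \<oplus>\<^bsub>free_space R B\<^esub> y \<oplus>\<^bsub>free_space R B\<^esub> z =
        x \<oplus>\<^bsub>free_space R B\<^esub> (y \<oplus>\<^bsub>free_space R B\<^esub> z)"
      by (auto intro!: restrict_ext a_assoc simp: PiE_mem)
  next
    fix x
    assume x: "x \<in> carrier (free_space R B)"
    show "\<zero>\<^bsub>free_space R B\<^esub> \<oplus>\<^bsub>free_space R B\<^esub> x = x"
      by (rule free_space_eqI[OF free_space_add_closed[OF free_space_zero_closed x] x])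
        (use x in \<open>auto simp: free_space_mem\<close>)
    \<comment> \<open>The inverse is taken as the multiple by -1, so that its finite support comes
      from \<open>free_space_smult_closed\<close>.\<close>
    have "(\<ominus> \<one>) \<odot>\<^bsub>free_space R B\<^esub> x \<oplus>\<^bsub>free_space R B\<^esub> x = \<zero>\<^bsub>free_space R B\<^esub>"
      using x by (auto intro!: restrict_ext simp: free_space_mem l_minus l_neg)
    then show "\<exists>y\<in>carrier (free_space R B). y \<oplus>\<^bsub>free_space R B\<^esub> x = \<zero>\<^bsub>free_space R B\<^esub>"
      using x free_space_smult_closed[of "\<ominus> \<one>" x B] by blast
  qed simp
next
  fix a x
  assume "a \<in> carrier R" "x \<in> carrier (free_space R B)"
  then show "a \<odot>\<^bsub>free_space R B\<^esub> x \<in> carrier (free_space R B)"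
    by (rule free_space_smult_closed)
next
  fix x
  assume x: "x \<in> carrier (free_space R B)"
  show "\<one> \<odot>\<^bsub>free_space R B\<^esub> x = x"
    by (rule free_space_eqI[OF free_space_smult_closed[OF one_closed x] x])
      (use x in \<open>auto simp: free_space_mem\<close>)
qed (auto intro!: restrict_ext is_cring simp: free_space_mem l_distr r_distr m_assoc)

lemma free_gen_closed: "b \<in> B \<Longrightarrow> free_gen R B b \<in> carrier (free_space R B)"
proof -
  have "{x \<in> B. free_gen R B b x \<noteq> \<zero>} \<subseteq> {b}"
    by (auto simp: free_gen_def)
  then have "finite {x \<in> B. free_gen R B b x \<noteq> \<zero>}"
    using finite_subset by blast
  then show ?thesis
    by (auto simp: free_gen_def)
qed

text \<open>A finitely supported function is a finite combination of generators; one point of its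
  support is split off at a time.\<close>

lemma free_space_induct [consumes 1, case_names zero step]:
  assumes "p \<in> carrier (free_space R B)"
    and zero: "P \<zero>\<^bsub>free_space R B\<^esub>"
    and step: "\<And>p a b. \<lbrakk>p \<in> carrier (free_space R B); P p; a \<in> carrier R; b \<in> B\<rbrakk>
      \<Longrightarrow> P (p \<oplus>\<^bsub>free_space R B\<^esub> a \<odot>\<^bsub>free_space R B\<^esub> free_gen R B b)"
  shows "P p"
proof -
  \<comment> \<open>The induction is on a finite superset \<open>S\<close> of the support, so that a
    point can be removed from \<open>S\<close> whether or not \<open>p\<close> vanishes
    there.\<close>
  have "P p" if "finite S" "p \<in> carrier (free_space R B)" "{b \<in> B. p b \<noteq> \<zero>} \<subseteq> S" for S p
    using that
  proof (induction S arbitrary: p rule: finite_induct)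
    case empty
    then have "p = \<zero>\<^bsub>free_space R B\<^esub>"
      by (intro free_space_eqI[OF _ free_space_zero_closed]) auto
    then show ?case
      using zero by (simp only:)
  next
    case (insert s S)
    show ?case
    proof (cases "s \<in> B")
      case False
      then have "{b \<in> B. p b \<noteq> \<zero>} \<subseteq> S"
        using insert.prems by blast
      then show ?thesis
        using insert by blast
    next
      case True
      let ?q = "p(s := \<zero>)"
      have fin: "finite {b \<in> B. ?q b \<noteq> \<zero>}"
        by (rule finite_subset[of _ "{b \<in> B. p b \<noteq> \<zero>}"]) (use insert.prems(1) in auto)
      have q: "?q \<in> carrier (free_space R B)"
        using insert.prems True fin by (auto simp: PiE_iff extensional_def)
      moreover have "{b \<in> B. ?q b \<noteq> \<zero>} \<subseteq> S"
        using insert.prems by auto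
      ultimately have "P ?q"
        using insert.IH by blast
      moreover have "p s \<in> carrier R"
        using insert.prems True by auto
      ultimately have "P (?q \<oplus>\<^bsub>free_space R B\<^esub> p s \<odot>\<^bsub>free_space R B\<^esub> free_gen R B s)"
        using q True by (intro step)
      also have "?q \<oplus>\<^bsub>free_space R B\<^esub> p s \<odot>\<^bsub>free_space R B\<^esub> free_gen R B s = p"
        using q \<open>p s \<in> carrier R\<close> True insert.prems(1)
        by (intro free_space_eqI[OF free_space_add_closed[OF q free_space_smult_closed[OF
                  _ free_gen_closed]]]) (auto simp: free_gen_def free_space_mem)
      finally show ?thesis .
    qed
  qed
  then show ?thesis
    using assms(1) by auto
qed

text \<open>The linear extension of \<open>\<phi>\<close> from generators to the free module. The
  sum over the support is the shape that occurs inside \<open>tensor_lift\<close>.\<close>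

definition free_lift :: "('a, 'p, 'z) module_scheme \<Rightarrow> 'i set \<Rightarrow> ('i \<Rightarrow> 'p) \<Rightarrow> ('i \<Rightarrow> 'a) \<Rightarrow> 'p" where
  "free_lift P B \<phi> p = (\<Oplus>\<^bsub>P\<^esub>z\<in>{z \<in> B. p z \<noteq> \<zero>}. p z \<odot>\<^bsub>P\<^esub> \<phi> z)"

text \<open>The support changes with \<open>p\<close>. Terms outside it are zero, so the sums for
  \<open>p\<close>, \<open>q\<close> and their sum can be taken over one common index set.\<close>

lemma free_lift_superset:
  assumes "module R P" "\<phi> \<in> B \<rightarrow> carrier P" "p \<in> carrier (free_space R B)"
    and "finite S" "S \<subseteq> B" "{z \<in> B. p z \<noteq> \<zero>} \<subseteq> S"
  shows "free_lift P B \<phi> p = (\<Oplus>\<^bsub>P\<^esub>z\<in>S. p z \<odot>\<^bsub>P\<^esub> \<phi> z)"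
proof -
  interpret P: module R P by fact
  show ?thesis
    unfolding free_lift_def
    using assms(2-) by (intro P.add.finprod_mono_neutral_cong_left) (auto simp: Pi_iff PiE_iff)
qed

lemma free_lift_hom:
  assumes P: "module R P" and \<phi>: "\<phi> \<in> B \<rightarrow> carrier P"
  shows "mod_hom R (free_space R B) P (free_lift P B \<phi>)"
proof -
  interpret P: module R P by fact
  have "free_lift P B \<phi> p \<in> carrier P" if "p \<in> carrier (free_space R B)" for p
    unfolding free_lift_def using that \<phi> by (intro P.finsum_closed) (auto simp: Pi_iff PiE_iff)
  moreover have "free_lift P B \<phi> (p \<oplus>\<^bsub>free_space R B\<^esub> q) =
      free_lift P B \<phi> p \<oplus>\<^bsub>P\<^esub> free_lift P B \<phi> q"
    if p: "p \<in> carrier (free_space R B)" and q: "q \<in> carrier (free_space R B)" for p q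
  proof -
    let ?S = "{z \<in> B. p z \<noteq> \<zero>} \<union> {z \<in> B. q z \<noteq> \<zero>}"
    have S: "finite ?S" "?S \<subseteq> B"
      using p q by auto
    have "free_lift P B \<phi> (p \<oplus>\<^bsub>free_space R B\<^esub> q) =
        (\<Oplus>\<^bsub>P\<^esub>z\<in>?S. (p \<oplus>\<^bsub>free_space R B\<^esub> q) z \<odot>\<^bsub>P\<^esub> \<phi> z)"
      using S free_space_add_closed[OF p q] by (intro free_lift_superset assms) auto
    also have "\<dots> = (\<Oplus>\<^bsub>P\<^esub>z\<in>?S. p z \<odot>\<^bsub>P\<^esub> \<phi> z \<oplus>\<^bsub>P\<^esub> q z \<odot>\<^bsub>P\<^esub> \<phi> z)"
      using p q \<phi> by (intro P.finsum_cong') (auto simp: P.smult_l_distr Pi_iff PiE_iff)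
    also have "\<dots> = (\<Oplus>\<^bsub>P\<^esub>z\<in>?S. p z \<odot>\<^bsub>P\<^esub> \<phi> z) \<oplus>\<^bsub>P\<^esub> (\<Oplus>\<^bsub>P\<^esub>z\<in>?S. q z \<odot>\<^bsub>P\<^esub> \<phi> z)"
      using p q \<phi> by (intro P.finsum_addf) (auto simp: Pi_iff PiE_iff)
    also have "\<dots> = free_lift P B \<phi> p \<oplus>\<^bsub>P\<^esub> free_lift P B \<phi> q"
      using S p q free_lift_superset[OF assms p, of ?S] free_lift_superset[OF assms q, of ?S]
      by auto
    finally show ?thesis .
  qed
  moreover have "free_lift P B \<phi> (a \<odot>\<^bsub>free_space R B\<^esub> p) = a \<odot>\<^bsub>P\<^esub> free_lift P B \<phi> p"
    if a: "a \<in> carrier R" and p: "p \<in> carrier (free_space R B)" for a p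
  proof -
    let ?S = "{z \<in> B. p z \<noteq> \<zero>}"
    have "free_lift P B \<phi> (a \<odot>\<^bsub>free_space R B\<^esub> p) =
        (\<Oplus>\<^bsub>P\<^esub>z\<in>?S. (a \<odot>\<^bsub>free_space R B\<^esub> p) z \<odot>\<^bsub>P\<^esub> \<phi> z)"
      using a p free_space_smult_closed[OF a p] by (intro free_lift_superset assms) auto
    also have "\<dots> = (\<Oplus>\<^bsub>P\<^esub>z\<in>?S. a \<odot>\<^bsub>P\<^esub> (p z \<odot>\<^bsub>P\<^esub> \<phi> z))"
      using a p \<phi> by (intro P.finsum_cong') (auto simp: P.smult_assoc1 Pi_iff PiE_iff)
    also have "\<dots> = a \<odot>\<^bsub>P\<^esub> free_lift P B \<phi> p"
      unfolding free_lift_def using a p \<phi>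
      by (intro P.finsum_smult[symmetric]) (auto simp: Pi_iff PiE_iff)
    finally show ?thesis .
  qed
  ultimately show ?thesis
    unfolding mod_hom_def mod_hom_axioms_def module_hom_def
    using P free_space_module by blast
qed

lemma free_lift_gen:
  assumes P: "module R P" and \<phi>: "\<phi> \<in> B \<rightarrow> carrier P" and b: "b \<in> B"
  shows "free_lift P B \<phi> (free_gen R B b) = \<phi> b"
proof -
  interpret P: module R P by fact
  have "free_lift P B \<phi> (free_gen R B b) = (\<Oplus>\<^bsub>P\<^esub>z\<in>{b}. free_gen R B b z \<odot>\<^bsub>P\<^esub> \<phi> z)"
    using b by (intro free_lift_superset assms free_gen_closed) (auto simp: free_gen_def)
  also have "\<dots> = \<phi> b"
    using b \<phi> by (simp add: free_gen_def Pi_iff)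
  finally show ?thesis .
qed

end

section \<open>Quotient modules and the maps induced on them\<close>

definition quotient_module ::
  "('k, 'v, 'x) module_scheme \<Rightarrow> 'v set \<Rightarrow> ('k, 'v set) module" where
  "quotient_module F N =
    \<lparr>carrier = a_rcosets\<^bsub>F\<^esub> N, mult = undefined, one = undefined, zero = N,
     add = set_add F, smult = (\<lambda>a X. \<Union>p\<in>X. N +>\<^bsub>F\<^esub> (a \<odot>\<^bsub>F\<^esub> p))\<rparr>"

context
  fixes R and F (structure) and N
  assumes module_F: "module R F" and submodule_N: "Module.submodule N R F"
begin

interpretation F: module R F by (rule module_F)
interpretation N: Module.submodule N R F by (rule submodule_N)
interpretation N: abelian_subgroup N F
  by (intro abelian_subgroupI3 additive_subgroupI N.subgroup_axioms) unfold_locales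

lemma coset_in_quotient: "p \<in> carrier F \<Longrightarrow> N +> p \<in> carrier (quotient_module F N)"
  unfolding quotient_module_def using F.a_rcosetsI[OF N.a_subset] by simp

lemma quotient_cosetE:
  assumes "X \<in> carrier (quotient_module F N)"
  obtains p where "p \<in> carrier F" "X = N +> p"
  using assms unfolding quotient_module_def A_RCOSETS_def' by auto

lemma quotient_add:
  "\<lbrakk>p \<in> carrier F; q \<in> carrier F\<rbrakk> \<Longrightarrow>
    (N +> p) \<oplus>\<^bsub>quotient_module F N\<^esub> (N +> q) = N +> (p \<oplus> q)"
  unfolding quotient_module_def using N.a_rcos_sum by simp

text \<open>The scalar multiple of a coset is a union over all its representatives. As
  \<open>N\<close> is closed under scalars, each representative contributes the same coset.\<close>

lemma quotient_smult:
  assumes a: "a \<in> carrier R" and p: "p \<in> carrier F"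
  shows "a \<odot>\<^bsub>quotient_module F N\<^esub> (N +> p) = N +> (a \<odot> p)"
proof -
  have "N +> (a \<odot> x) = N +> (a \<odot> p)" if x: "x \<in> N +> p" for x
  proof -
    obtain n where n: "n \<in> N" "x = n \<oplus> p"
      using x unfolding a_r_coset_def' by blast
    have "a \<odot> x = a \<odot> n \<oplus> a \<odot> p"
      unfolding n(2) using a p n(1) N.a_subset by (intro F.smult_r_distr) auto
    moreover have "a \<odot> n \<in> N"
      using a n(1) by (rule N.smult_closed)
    ultimately have "a \<odot> x \<in> N +> (a \<odot> p)"
      unfolding a_r_coset_def' by blast
    then show ?thesis
      using N.a_repr_independence' F.smult_closed[OF a p] by metis
  qed
  moreover have "p \<in> N +> p"
    using p by (rule N.a_rcos_self)
  ultimately have "(\<Union>x\<in>N +> p. N +> (a \<odot> x)) = N +> (a \<odot> p)"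
    by blast
  then show ?thesis
    unfolding quotient_module_def by simp
qed

lemma quotient_zero: "\<zero>\<^bsub>quotient_module F N\<^esub> = N +> \<zero>"
  unfolding quotient_module_def using F.a_coset_add_zero[OF N.a_subset] by simp

lemma quotient_module: "module R (quotient_module F N)"
proof (rule moduleI)
  show "abelian_group (quotient_module F N)"
  proof (rule abelian_groupI)
    fix X assume "X \<in> carrier (quotient_module F N)"
    then obtain p where "p \<in> carrier F" "X = N +> p"
      by (rule quotient_cosetE)
    then show "\<exists>Y\<in>carrier (quotient_module F N).
        Y \<oplus>\<^bsub>quotient_module F N\<^esub> X = \<zero>\<^bsub>quotient_module F N\<^esub>"
      by (intro bexI[of _ "N +> (\<ominus> p)"])
        (simp_all add: coset_in_quotient quotient_add quotient_zero F.l_neg)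
  next
    show "X \<oplus>\<^bsub>quotient_module F N\<^esub> Y \<in> carrier (quotient_module F N)"
      if X: "X \<in> carrier (quotient_module F N)" and Y: "Y \<in> carrier (quotient_module F N)" for X Y
      using X Y
      by (elim quotient_cosetE) (simp add: quotient_add coset_in_quotient)
    show "X \<oplus>\<^bsub>quotient_module F N\<^esub> Y = Y \<oplus>\<^bsub>quotient_module F N\<^esub> X"
      if X: "X \<in> carrier (quotient_module F N)" and Y: "Y \<in> carrier (quotient_module F N)" for X Y
      using X Y
      by (elim quotient_cosetE) (simp add: quotient_add F.a_comm)
    show "X \<oplus>\<^bsub>quotient_module F N\<^esub> Y \<oplus>\<^bsub>quotient_module F N\<^esub> Z = X \<oplus>\<^bsub>quotient_module F N\<^esub> (Y \<oplus>\<^bsub>quotient_module F N\<^esub> Z)"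
      if X: "X \<in> carrier (quotient_module F N)" and Y: "Y \<in> carrier (quotient_module F N)"
        and Z: "Z \<in> carrier (quotient_module F N)" for X Y Z
      using X Y Z
      by (elim quotient_cosetE) (simp add: quotient_add F.a_assoc)
    show "\<zero>\<^bsub>quotient_module F N\<^esub> \<oplus>\<^bsub>quotient_module F N\<^esub> X = X"
      if X: "X \<in> carrier (quotient_module F N)" for X
      using X by (elim quotient_cosetE) (simp add: quotient_add quotient_zero)
  qed (simp only: quotient_zero, intro coset_in_quotient F.zero_closed)
next
  show "(a \<oplus>\<^bsub>R\<^esub> b) \<odot>\<^bsub>quotient_module F N\<^esub> X = a \<odot>\<^bsub>quotient_module F N\<^esub> X \<oplus>\<^bsub>quotient_module F N\<^esub> b \<odot>\<^bsub>quotient_module F N\<^esub> X"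
    if "a \<in> carrier R" "b \<in> carrier R" "X \<in> carrier (quotient_module F N)" for a b X
    using that(3)
    by (rule quotient_cosetE) (use that in \<open>simp add: quotient_smult quotient_add F.smult_l_distr\<close>)
  show "a \<odot>\<^bsub>quotient_module F N\<^esub> (X \<oplus>\<^bsub>quotient_module F N\<^esub> Y) = a \<odot>\<^bsub>quotient_module F N\<^esub> X \<oplus>\<^bsub>quotient_module F N\<^esub> a \<odot>\<^bsub>quotient_module F N\<^esub> Y"
    if a: "a \<in> carrier R" and XY: "X \<in> carrier (quotient_module F N)"
      "Y \<in> carrier (quotient_module F N)" for a X Y
  proof -
    obtain p where "p \<in> carrier F" "X = N +> p"
      using XY(1) by (rule quotient_cosetE)
    moreover obtain q where "q \<in> carrier F" "Y = N +> q"
      using XY(2) by (rule quotient_cosetE)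
    ultimately show ?thesis
      using a by (simp add: quotient_smult quotient_add F.smult_r_distr)
  qed
  show "(a \<otimes>\<^bsub>R\<^esub> b) \<odot>\<^bsub>quotient_module F N\<^esub> X = a \<odot>\<^bsub>quotient_module F N\<^esub> (b \<odot>\<^bsub>quotient_module F N\<^esub> X)"
    if "a \<in> carrier R" "b \<in> carrier R" "X \<in> carrier (quotient_module F N)" for a b X
    using that(3)
    by (rule quotient_cosetE) (use that in \<open>simp add: quotient_smult F.smult_assoc1\<close>)
  show "a \<odot>\<^bsub>quotient_module F N\<^esub> X \<in> carrier (quotient_module F N)"
    if "a \<in> carrier R" "X \<in> carrier (quotient_module F N)" for a X
    using that(2)
    by (rule quotient_cosetE) (use that in \<open>simp add: quotient_smult coset_in_quotient\<close>)
  show "\<one>\<^bsub>R\<^esub> \<odot>\<^bsub>quotient_module F N\<^esub> X = X" if "X \<in> carrier (quotient_module F N)" for X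
    using that by (rule quotient_cosetE) (simp add: quotient_smult)
qed (rule F.is_cring)

lemma quotient_proj_hom: "mod_hom R F (quotient_module F N) (\<lambda>p. N +> p)"
  by (rule mod_homI[OF module_F quotient_module])
    (simp_all only: coset_in_quotient quotient_add quotient_smult)

text \<open>A homomorphism that vanishes on \<open>N\<close> is constant on cosets, so the image of
  a coset is a singleton and \<open>the_elem\<close> picks its value.\<close>

lemma quotient_lift_coset:
  assumes f: "mod_hom R F P f" and null: "\<And>n. n \<in> N \<Longrightarrow> f n = \<zero>\<^bsub>P\<^esub>" and p: "p \<in> carrier F"
  shows "the_elem (f ` (N +> p)) = f p"
proof -
  interpret P: module R P by (rule mod_homD(2)[OF f])
  have "f x = f p" if x: "x \<in> N +> p" for x
  proof -
    obtain n where n: "n \<in> N" "x = n \<oplus> p"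
      using x unfolding a_r_coset_def' by blast
    then have "n \<in> carrier F"
      using N.a_subset by blast
    then show ?thesis
      using n p by (simp add: mod_homD(3,4)[OF f] null)
  qed
  moreover have "p \<in> N +> p"
    using p by (rule N.a_rcos_self)
  ultimately have "f ` (N +> p) = {f p}"
    by blast
  then show ?thesis
    by simp
qed

lemma quotient_lift_hom:
  assumes f: "mod_hom R F P f" and null: "\<And>n. n \<in> N \<Longrightarrow> f n = \<zero>\<^bsub>P\<^esub>"
  shows "mod_hom R (quotient_module F N) P (\<lambda>X. the_elem (f ` X))"
proof (rule mod_homI)
  show "the_elem (f ` X) \<in> carrier P" if "X \<in> carrier (quotient_module F N)" for X
    using that by (rule quotient_cosetE) (simp add: quotient_lift_coset[OF assms] mod_homD(3)[OF f])
  show "the_elem (f ` (X \<oplus>\<^bsub>quotient_module F N\<^esub> Y)) = the_elem (f ` X) \<oplus>\<^bsub>P\<^esub> the_elem (f ` Y)"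
    if XY: "X \<in> carrier (quotient_module F N)" "Y \<in> carrier (quotient_module F N)" for X Y
  proof -
    obtain p where "p \<in> carrier F" "X = N +> p"
      using XY(1) by (rule quotient_cosetE)
    moreover obtain q where "q \<in> carrier F" "Y = N +> q"
      using XY(2) by (rule quotient_cosetE)
    ultimately show ?thesis
      by (simp add: quotient_lift_coset[OF assms] quotient_add mod_homD(4)[OF f])
  qed
  show "the_elem (f ` (a \<odot>\<^bsub>quotient_module F N\<^esub> X)) = a \<odot>\<^bsub>P\<^esub> the_elem (f ` X)"
    if a: "a \<in> carrier R" and X: "X \<in> carrier (quotient_module F N)" for a X
    using X by (rule quotient_cosetE)
      (use a in \<open>simp add: quotient_lift_coset[OF assms] quotient_smult mod_homD(5)[OF f]\<close>)
qed (rule quotient_module, rule mod_homD(2)[OF f])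

end

section \<open>The universal property of the tensor product\<close>

definition bilinear_map ::
  "('k, 'r) ring_scheme \<Rightarrow> ('k, 'v, 'x) module_scheme \<Rightarrow> ('k, 'w, 'y) module_scheme
    \<Rightarrow> ('k, 'p, 'z) module_scheme \<Rightarrow> ('v \<Rightarrow> 'w \<Rightarrow> 'p) \<Rightarrow> bool" where
  "bilinear_map K V W P \<beta> \<longleftrightarrow>
    module K V \<and> module K W \<and> module K P \<and>
    (\<forall>w\<in>carrier W. mod_hom K V P (\<lambda>v. \<beta> v w)) \<and> (\<forall>v\<in>carrier V. mod_hom K W P (\<beta> v))"

lemma bilinear_mapI:
  assumes "module K V" "module K W" "module K P"
    and "\<And>w. w \<in> carrier W \<Longrightarrow> mod_hom K V P (\<lambda>v. \<beta> v w)"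
    and "\<And>v. v \<in> carrier V \<Longrightarrow> mod_hom K W P (\<beta> v)"
  shows "bilinear_map K V W P \<beta>"
  using assms by (simp add: bilinear_map_def)

lemma bilinear_mapD:
  assumes "bilinear_map K V W P \<beta>"
  shows "module K V" "module K W" "module K P"
    and "w \<in> carrier W \<Longrightarrow> mod_hom K V P (\<lambda>v. \<beta> v w)"
    and "v \<in> carrier V \<Longrightarrow> mod_hom K W P (\<beta> v)"
  using assms by (simp_all add: bilinear_map_def)

text \<open>\<open>quotient_module\<close> copies the record in \<open>tensor\<close> field by
  field, so everything shown for a general submodule applies to \<open>tensor_null\<close>.\<close>

lemma tensor_eq_quotient:
  "tensor K V W = quotient_module (free_space K (carrier V \<times> carrier W)) (tensor_null K V W)"
  by (simp add: tensor_def quotient_module_def Let_def)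

context cring
begin

lemma tensor_relators_closed:
  assumes V: "module R V" and W: "module R W"
  shows "tensor_relators R V W \<subseteq> carrier (free_space R (carrier V \<times> carrier W))"
proof -
  interpret V: module R V by fact
  interpret W: module R W by fact
  interpret F: module R "free_space R (carrier V \<times> carrier W)" by (rule free_space_module)
  show ?thesis
    unfolding tensor_relators_def Let_def
    by (auto intro!: F.M.minus_closed F.M.add.m_closed F.smult_closed free_gen_closed
        simp del: free_space_simps)
qed

text \<open>The span is a submodule in the sense of \<open>LinearCombinations\<close>, whereas the
  coset theory needs an additive subgroup. Closure under negation is supplied by the scalar
  -1.\<close>

lemma tensor_null_submodule:
  assumes V: "module R V" and W: "module R W"
  shows "Module.submodule (tensor_null R V W) R (free_space R (carrier V \<times> carrier W))"
proof -
  interpret F: module R "free_space R (carrier V \<times> carrier W)" by (rule free_space_module)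
  interpret N: LinearCombinations.submodule R "tensor_null R V W"
      "free_space R (carrier V \<times> carrier W)"
    unfolding tensor_null_def by (rule F.span_is_submodule[OF tensor_relators_closed[OF assms]])
  have neg: "\<ominus>\<^bsub>free_space R (carrier V \<times> carrier W)\<^esub> n \<in> tensor_null R V W"
    if "n \<in> tensor_null R V W" for n
    using that N.smult_closed[of "\<ominus> \<one>" n] F.smult_minus_1[of n] N.subset by auto
  show ?thesis
    by (rule F.submoduleI) (use neg N.subset N.smult_closed N.m_closed N.zero_closed in blast)+
qed

lemma tensor_module: "\<lbrakk>module R V; module R W\<rbrakk> \<Longrightarrow> module R (tensor R V W)"
  unfolding tensor_eq_quotient
  by (rule quotient_module[OF free_space_module tensor_null_submodule])

lemma tensor_proj_hom:
  "\<lbrakk>module R V; module R W\<rbrakk> \<Longrightarrow> mod_hom R (free_space R (carrier V \<times> carrier W)) (tensor R V W)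
    (\<lambda>p. tensor_null R V W +>\<^bsub>free_space R (carrier V \<times> carrier W)\<^esub> p)"
  unfolding tensor_eq_quotient
  by (rule quotient_proj_hom[OF free_space_module tensor_null_submodule])

lemma pure_tensor_closed:
  assumes "module R V" "module R W" "v \<in> carrier V" "w \<in> carrier W"
  shows "pure_tensor R V W v w \<in> carrier (tensor R V W)"
  unfolding pure_tensor_def
  using assms by (intro mod_homD(3)[OF tensor_proj_hom] free_gen_closed) auto

text \<open>The kernel of \<open>f\<close> is a submodule containing the relators, hence it contains
  their span.\<close>

lemma hom_tensor_null:
  assumes V: "module R V" and W: "module R W"
    and f: "mod_hom R (free_space R (carrier V \<times> carrier W)) P f"
    and relators: "\<And>r. r \<in> tensor_relators R V W \<Longrightarrow> f r = \<zero>\<^bsub>P\<^esub>"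
    and n: "n \<in> tensor_null R V W"
  shows "f n = \<zero>\<^bsub>P\<^esub>"
proof -
  interpret F: module R "free_space R (carrier V \<times> carrier W)" by (rule free_space_module)
  interpret f: mod_hom R "free_space R (carrier V \<times> carrier W)" P f by fact
  have "tensor_relators R V W \<subseteq> f.ker"
    using tensor_relators_closed[OF V W] relators unfolding f.ker_def by blast
  then have "tensor_null R V W \<subseteq> f.ker"
    unfolding tensor_null_def by (rule F.span_is_subset[OF _ f.ker_is_submodule])
  then show ?thesis
    using n unfolding f.ker_def by blast
qed

lemma tensor_proj_relator:
  assumes V: "module R V" and W: "module R W" and r: "r \<in> tensor_relators R V W"
  shows "tensor_null R V W +>\<^bsub>free_space R (carrier V \<times> carrier W)\<^esub> r = \<zero>\<^bsub>tensor R V W\<^esub>"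
proof -
  interpret F: module R "free_space R (carrier V \<times> carrier W)" by (rule free_space_module)
  have "r \<in> tensor_null R V W"
    unfolding tensor_null_def
    using F.in_own_span[OF tensor_relators_closed[OF V W]] r by blast
  then have "tensor_null R V W +>\<^bsub>free_space R (carrier V \<times> carrier W)\<^esub> r = tensor_null R V W"
    using F.a_coset_join2 tensor_null_submodule[OF V W] tensor_relators_closed[OF V W] r
    unfolding Module.submodule_def by blast
  then show ?thesis
    by (simp add: tensor_def Let_def)
qed

lemma pure_tensor_bilinear:
  assumes V: "module R V" and W: "module R W"
  shows "bilinear_map R V W (tensor R V W) (pure_tensor R V W)"
proof -
  interpret V: module R V by fact
  interpret W: module R W by fact
  interpret T: module R "tensor R V W" by (rule tensor_module[OF V W])
  let ?F = "free_space R (carrier V \<times> carrier W)"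
  let ?e = "\<lambda>v w. free_gen R (carrier V \<times> carrier W) (v, w)"
  interpret F: module R ?F by (rule free_space_module)
  note [simp del] = free_space_simps
  note proj = tensor_proj_hom[OF V W]
  have e: "?e v w \<in> carrier ?F" if "v \<in> carrier V" "w \<in> carrier W" for v w
    using that by (intro free_gen_closed) simp
  \<comment> \<open>Each relator is a difference \<open>x - y\<close>, and its class is zero; this
    turns it into an equality of the classes of \<open>x\<close> and \<open>y\<close>.\<close>
  have eqI: "tensor_null R V W +>\<^bsub>?F\<^esub> x = tensor_null R V W +>\<^bsub>?F\<^esub> y"
    if "x \<ominus>\<^bsub>?F\<^esub> y \<in> tensor_relators R V W" "x \<in> carrier ?F" "y \<in> carrier ?F" for x y
    using tensor_proj_relator[OF V W that(1)] that(2,3)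
    by (simp add: mod_homD(3,7)[OF proj])
  have "pure_tensor R V W (v \<oplus>\<^bsub>V\<^esub> v') w =
      pure_tensor R V W v w \<oplus>\<^bsub>tensor R V W\<^esub> pure_tensor R V W v' w"
    if "v \<in> carrier V" "v' \<in> carrier V" "w \<in> carrier W" for v v' w
  proof -
    have "?e (v \<oplus>\<^bsub>V\<^esub> v') w \<ominus>\<^bsub>?F\<^esub> (?e v w \<oplus>\<^bsub>?F\<^esub> ?e v' w) \<in> tensor_relators R V W"
      unfolding tensor_relators_def Let_def using that by blast
    then show ?thesis
      unfolding pure_tensor_def using that e
      by (subst eqI) (auto simp: mod_homD(4)[OF proj])
  qed
  moreover have "pure_tensor R V W v (w \<oplus>\<^bsub>W\<^esub> w') =
      pure_tensor R V W v w \<oplus>\<^bsub>tensor R V W\<^esub> pure_tensor R V W v w'"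
    if "v \<in> carrier V" "w \<in> carrier W" "w' \<in> carrier W" for v w w'
  proof -
    have "?e v (w \<oplus>\<^bsub>W\<^esub> w') \<ominus>\<^bsub>?F\<^esub> (?e v w \<oplus>\<^bsub>?F\<^esub> ?e v w') \<in> tensor_relators R V W"
      unfolding tensor_relators_def Let_def using that by blast
    then show ?thesis
      unfolding pure_tensor_def using that e
      by (subst eqI) (auto simp: mod_homD(4)[OF proj])
  qed
  moreover have "pure_tensor R V W (a \<odot>\<^bsub>V\<^esub> v) w = a \<odot>\<^bsub>tensor R V W\<^esub> pure_tensor R V W v w"
    if "a \<in> carrier R" "v \<in> carrier V" "w \<in> carrier W" for a v w
  proof -
    have "?e (a \<odot>\<^bsub>V\<^esub> v) w \<ominus>\<^bsub>?F\<^esub> (a \<odot>\<^bsub>?F\<^esub> ?e v w) \<in> tensor_relators R V W"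
      unfolding tensor_relators_def Let_def using that by blast
    then show ?thesis
      unfolding pure_tensor_def using that e
      by (subst eqI) (auto simp: mod_homD(5)[OF proj])
  qed
  moreover have "pure_tensor R V W v (a \<odot>\<^bsub>W\<^esub> w) = a \<odot>\<^bsub>tensor R V W\<^esub> pure_tensor R V W v w"
    if "a \<in> carrier R" "v \<in> carrier V" "w \<in> carrier W" for a v w
  proof -
    have "?e v (a \<odot>\<^bsub>W\<^esub> w) \<ominus>\<^bsub>?F\<^esub> (a \<odot>\<^bsub>?F\<^esub> ?e v w) \<in> tensor_relators R V W"
      unfolding tensor_relators_def Let_def using that by blast
    then show ?thesis
      unfolding pure_tensor_def using that e
      by (subst eqI) (auto simp: mod_homD(5)[OF proj])
  qed
  ultimately show ?thesis
    by (intro bilinear_mapI mod_homI V W tensor_module pure_tensor_closed)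
qed

text \<open>This makes \<open>tensor_lift\<close> well defined: each of the four families of
  relators is killed by additivity or homogeneity of \<open>\<beta>\<close> in one argument.\<close>

lemma free_lift_tensor_null:
  assumes \<beta>: "bilinear_map R V W P \<beta>" and n: "n \<in> tensor_null R V W"
  shows "free_lift P (carrier V \<times> carrier W) (case_prod \<beta>) n = \<zero>\<^bsub>P\<^esub>"
proof (rule hom_tensor_null[OF bilinear_mapD(1,2)[OF \<beta>] _ _ n])
  interpret V: module R V by (rule bilinear_mapD(1)[OF \<beta>])
  interpret W: module R W by (rule bilinear_mapD(2)[OF \<beta>])
  interpret P: module R P by (rule bilinear_mapD(3)[OF \<beta>])
  let ?B = "carrier V \<times> carrier W"
  interpret F: module R "free_space R ?B" by (rule free_space_module)
  note [simp del] = free_space_simps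
  have \<phi>: "case_prod \<beta> \<in> ?B \<rightarrow> carrier P"
    using mod_homD(3)[OF bilinear_mapD(5)[OF \<beta>]] by auto
  show hom: "mod_hom R (free_space R ?B) P (free_lift P ?B (case_prod \<beta>))"
    by (rule free_lift_hom[OF P.module_axioms \<phi>])
  note lift [simp] = mod_homD(4,5,7)[OF hom]
  have e [simp]: "free_gen R ?B (v, w) \<in> carrier (free_space R ?B)"
    "free_lift P ?B (case_prod \<beta>) (free_gen R ?B (v, w)) = \<beta> v w"
    "\<beta> v w \<in> carrier P"
    if "v \<in> carrier V" "w \<in> carrier W" for v w
    using that funcset_mem[OF \<phi>, of "(v, w)"]
    by (auto intro!: free_gen_closed simp: free_lift_gen[OF P.module_axioms \<phi>])
  fix r
  assume "r \<in> tensor_relators R V W"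
  then show "free_lift P ?B (case_prod \<beta>) r = \<zero>\<^bsub>P\<^esub>"
    unfolding tensor_relators_def Let_def
    by (elim UnE CollectE exE conjE)
      (simp_all add: mod_homD(4,5)[OF bilinear_mapD(4)[OF \<beta>]] mod_homD(4,5)[OF bilinear_mapD(5)[OF \<beta>]])
qed

lemma tensor_lift_eq:
  "tensor_lift R V W P \<beta> = (\<lambda>X. the_elem (free_lift P (carrier V \<times> carrier W) (case_prod \<beta>) ` X))"
  by (simp add: tensor_lift_def free_lift_def case_prod_beta fun_eq_iff)

lemma tensor_lift_hom:
  assumes \<beta>: "bilinear_map R V W P \<beta>"
  shows "mod_hom R (tensor R V W) P (tensor_lift R V W P \<beta>)"
proof -
  have "case_prod \<beta> \<in> carrier V \<times> carrier W \<rightarrow> carrier P"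
    using mod_homD(3)[OF bilinear_mapD(5)[OF \<beta>]] by auto
  then show ?thesis
    unfolding tensor_lift_eq tensor_eq_quotient
    by (intro quotient_lift_hom free_space_module tensor_null_submodule bilinear_mapD(1-3)[OF \<beta>]
        free_lift_hom free_lift_tensor_null[OF \<beta>])
qed

lemma tensor_lift_pure:
  assumes \<beta>: "bilinear_map R V W P \<beta>" and v: "v \<in> carrier V" and w: "w \<in> carrier W"
  shows "tensor_lift R V W P \<beta> (pure_tensor R V W v w) = \<beta> v w"
proof -
  have \<phi>: "case_prod \<beta> \<in> carrier V \<times> carrier W \<rightarrow> carrier P"
    using mod_homD(3)[OF bilinear_mapD(5)[OF \<beta>]] by auto
  note P = bilinear_mapD(3)[OF \<beta>]
  have "tensor_lift R V W P \<beta> (pure_tensor R V W v w) =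
      free_lift P (carrier V \<times> carrier W) (case_prod \<beta>) (free_gen R (carrier V \<times> carrier W) (v, w))"
    unfolding tensor_lift_eq pure_tensor_def
    by (rule quotient_lift_coset[OF free_space_module tensor_null_submodule[OF
              bilinear_mapD(1,2)[OF \<beta>]] free_lift_hom[OF P \<phi>] free_lift_tensor_null[OF \<beta>]])
      (use v w in \<open>auto intro: free_gen_closed simp del: free_space_simps\<close>)
  also have "\<dots> = \<beta> v w"
    using v w by (subst free_lift_gen[OF P \<phi>]) auto
  finally show ?thesis .
qed

text \<open>Every class has a representative that is a finite combination of generators, so
  induction over the free module compares two linear maps. This takes the place of computing with
  Sweedler components.\<close>

lemma tensor_ext:
  assumes V: "module R V" and W: "module R W"
    and f: "mod_hom R (tensor R V W) P f" and g: "mod_hom R (tensor R V W) P g"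
    and eq: "\<And>v w. \<lbrakk>v \<in> carrier V; w \<in> carrier W\<rbrakk> \<Longrightarrow>
      f (pure_tensor R V W v w) = g (pure_tensor R V W v w)"
    and X: "X \<in> carrier (tensor R V W)"
  shows "f X = g X"
proof -
  let ?F = "free_space R (carrier V \<times> carrier W)"
  interpret F: module R ?F by (rule free_space_module)
  note proj = tensor_proj_hom[OF V W]
  note closed = mod_homD(3)[OF proj]
  obtain p where p: "p \<in> carrier ?F" and X: "X = tensor_null R V W +>\<^bsub>?F\<^esub> p"
    using X unfolding tensor_eq_quotient
    by (rule quotient_cosetE[OF free_space_module tensor_null_submodule[OF V W]])
  from p have "f (tensor_null R V W +>\<^bsub>?F\<^esub> p) = g (tensor_null R V W +>\<^bsub>?F\<^esub> p)"
  proof (induction p rule: free_space_induct)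
    case zero
    show ?case
      unfolding mod_homD(6)[OF proj] mod_homD(6)[OF f] mod_homD(6)[OF g] ..
  next
    case (step p a b)
    obtain v w where b: "b = (v, w)" "v \<in> carrier V" "w \<in> carrier W"
      using step.hyps(3) by blast
    have e: "free_gen R (carrier V \<times> carrier W) b \<in> carrier ?F"
      using step.hyps(3) by (rule free_gen_closed)
    then have ae: "a \<odot>\<^bsub>?F\<^esub> free_gen R (carrier V \<times> carrier W) b \<in> carrier ?F"
      using step.hyps(2) by (intro F.smult_closed)
    have "f (tensor_null R V W +>\<^bsub>?F\<^esub> free_gen R (carrier V \<times> carrier W) b) =
        g (tensor_null R V W +>\<^bsub>?F\<^esub> free_gen R (carrier V \<times> carrier W) b)"
      using eq b unfolding pure_tensor_def by blast
    then show ?case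
      using step.IH
      by (simp only: mod_homD(4)[OF proj step.hyps(1) ae] mod_homD(5)[OF proj step.hyps(2) e]
          mod_homD(4,5)[OF f] mod_homD(4,5)[OF g] closed[OF step.hyps(1)] closed[OF ae] closed[OF e]
          step.hyps(2) module.smult_closed[OF tensor_module[OF V W]])
  qed
  then show ?thesis
    unfolding X .
qed

end

section \<open>Functoriality of the tensor product\<close>

lemma mod_hom_comp:
  assumes f: "mod_hom R U V f" and g: "mod_hom R V W g"
  shows "mod_hom R U W (\<lambda>x. g (f x))"
  by (rule mod_homI[OF mod_homD(1)[OF f] mod_homD(2)[OF g]])
    (simp_all add: mod_homD(3-5)[OF f] mod_homD(3-5)[OF g])

lemma mod_hom_ident: "module R V \<Longrightarrow> mod_hom R V V (\<lambda>x. x)"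
  by (rule mod_homI) simp_all

lemma mod_hom_id: "module R V \<Longrightarrow> mod_hom R V V id"
  by (rule mod_homI) simp_all

lemma (in abelian_group) add_add_swap:
  "\<lbrakk>a \<in> carrier G; b \<in> carrier G; c \<in> carrier G; d \<in> carrier G\<rbrakk> \<Longrightarrow>
    (a \<oplus> b) \<oplus> (c \<oplus> d) = (a \<oplus> c) \<oplus> (b \<oplus> d)"
  by (simp add: a_ac)

lemma (in abelian_group) minus_eq_minus_iff:
  assumes [simp]: "a \<in> carrier G" "b \<in> carrier G" "c \<in> carrier G" "d \<in> carrier G"
  shows "a \<ominus> b = c \<ominus> d \<longleftrightarrow> a \<oplus> d = c \<oplus> b"
proof -
  have "a \<ominus> b = c \<ominus> d \<longleftrightarrow> (a \<ominus> b) \<oplus> (b \<oplus> d) = (c \<ominus> d) \<oplus> (b \<oplus> d)"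
    by simp
  also have "(a \<ominus> b) \<oplus> (b \<oplus> d) = a \<oplus> d"
    by (simp add: a_minus_def a_assoc r_neg1)
  also have "(c \<ominus> d) \<oplus> (b \<oplus> d) = c \<oplus> b"
    using r_neg1[of d b] by (simp add: a_minus_def a_assoc a_comm[of b d])
  finally show ?thesis .
qed

lemma (in abelian_group) minus_add_minus:
  "\<lbrakk>a \<in> carrier G; b \<in> carrier G; c \<in> carrier G; d \<in> carrier G\<rbrakk> \<Longrightarrow>
    (a \<ominus> b) \<oplus> (c \<ominus> d) = (a \<oplus> c) \<ominus> (b \<oplus> d)"
  by (simp add: a_minus_def minus_add a_ac)

lemma mod_hom_plus:
  assumes f: "mod_hom R U V f" and g: "mod_hom R U V g"
  shows "mod_hom R U V (\<lambda>x. f x \<oplus>\<^bsub>V\<^esub> g x)"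
proof -
  interpret V: module R V by (rule mod_homD(2)[OF f])
  show ?thesis
    by (rule mod_homI[OF mod_homD(1,2)[OF f]])
      (simp_all add: mod_homD(3-5)[OF f] mod_homD(3-5)[OF g] V.smult_r_distr V.add_add_swap)
qed

lemma mod_hom_minus:
  assumes f: "mod_hom R U V f" and g: "mod_hom R U V g"
  shows "mod_hom R U V (\<lambda>x. f x \<ominus>\<^bsub>V\<^esub> g x)"
proof -
  interpret V: module R V by (rule mod_homD(2)[OF f])
  show ?thesis
    by (rule mod_homI[OF mod_homD(1,2)[OF f]])
      (simp_all add: mod_homD(3-5)[OF f] mod_homD(3-5)[OF g] V.minus_add_minus
        a_minus_def[of V] V.smult_r_distr V.smult_r_minus V.minus_add V.add_add_swap)
qed

context cring
begin

lemma pure_hom_left: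
  assumes "module R W" "w \<in> carrier W" "mod_hom R U V f"
  shows "mod_hom R U (tensor R V W) (\<lambda>x. pure_tensor R V W (f x) w)"
  by (rule mod_hom_comp[OF assms(3) bilinear_mapD(4)[OF
          pure_tensor_bilinear[OF mod_homD(2)[OF assms(3)] assms(1)] assms(2)]])

lemma pure_hom_right:
  assumes "module R V" "v \<in> carrier V" "mod_hom R U W f"
  shows "mod_hom R U (tensor R V W) (\<lambda>x. pure_tensor R V W v (f x))"
  by (rule mod_hom_comp[OF assms(3) bilinear_mapD(5)[OF
          pure_tensor_bilinear[OF assms(1) mod_homD(2)[OF assms(3)]] assms(2)]])

lemma pure_tensor_minus_left:
  assumes "module R V" "module R W" "v \<in> carrier V" "v' \<in> carrier V" "w \<in> carrier W"
  shows "pure_tensor R V W (v \<ominus>\<^bsub>V\<^esub> v') w =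
    pure_tensor R V W v w \<ominus>\<^bsub>tensor R V W\<^esub> pure_tensor R V W v' w"
  by (rule mod_homD(7)[OF bilinear_mapD(4)[OF pure_tensor_bilinear]]) (rule assms)+

lemma pure_tensor_minus_right:
  assumes "module R V" "module R W" "v \<in> carrier V" "w \<in> carrier W" "w' \<in> carrier W"
  shows "pure_tensor R V W v (w \<ominus>\<^bsub>W\<^esub> w') =
    pure_tensor R V W v w \<ominus>\<^bsub>tensor R V W\<^esub> pure_tensor R V W v w'"
  by (rule mod_homD(7)[OF bilinear_mapD(5)[OF pure_tensor_bilinear]]) (rule assms)+

lemma pure_tensor_add_left:
  assumes "module R V" "module R W" "v \<in> carrier V" "v' \<in> carrier V" "w \<in> carrier W"
  shows "pure_tensor R V W (v \<oplus>\<^bsub>V\<^esub> v') w =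
    pure_tensor R V W v w \<oplus>\<^bsub>tensor R V W\<^esub> pure_tensor R V W v' w"
  by (rule mod_homD(4)[OF bilinear_mapD(4)[OF pure_tensor_bilinear]]) (rule assms)+

lemma pure_tensor_add_right:
  assumes "module R V" "module R W" "v \<in> carrier V" "w \<in> carrier W" "w' \<in> carrier W"
  shows "pure_tensor R V W v (w \<oplus>\<^bsub>W\<^esub> w') =
    pure_tensor R V W v w \<oplus>\<^bsub>tensor R V W\<^esub> pure_tensor R V W v w'"
  by (rule mod_homD(4)[OF bilinear_mapD(5)[OF pure_tensor_bilinear]]) (rule assms)+

lemma tensor_map_bilinear:
  assumes f: "mod_hom R V V' f" and g: "mod_hom R W W' g"
  shows "bilinear_map R V W (tensor R V' W') (\<lambda>v w. pure_tensor R V' W' (f v) (g w))"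
  by (intro bilinear_mapI pure_hom_left pure_hom_right tensor_module f g
      mod_homD(1,2)[OF f] mod_homD(1,2)[OF g] mod_homD(3)[OF f] mod_homD(3)[OF g])

lemma tensor_map_hom:
  assumes "mod_hom R V V' f" "mod_hom R W W' g"
  shows "mod_hom R (tensor R V W) (tensor R V' W') (tensor_map R V W V' W' f g)"
  unfolding tensor_map_def by (rule tensor_lift_hom[OF tensor_map_bilinear[OF assms]])

lemma tensor_map_pure:
  assumes "mod_hom R V V' f" "mod_hom R W W' g" "v \<in> carrier V" "w \<in> carrier W"
  shows "tensor_map R V W V' W' f g (pure_tensor R V W v w) = pure_tensor R V' W' (f v) (g w)"
  unfolding tensor_map_def
  by (rule tensor_lift_pure[OF tensor_map_bilinear[OF assms(1,2)] assms(3,4)])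

lemma tensor_swap_bilinear:
  assumes "module R V" "module R W"
  shows "bilinear_map R V W (tensor R W V) (\<lambda>v w. pure_tensor R W V w v)"
  using assms by (intro bilinear_mapI pure_hom_left pure_hom_right tensor_module mod_hom_ident)

lemma tensor_swap_hom:
  assumes "module R V" "module R W"
  shows "mod_hom R (tensor R V W) (tensor R W V) (tensor_swap R V W)"
  unfolding tensor_swap_def by (rule tensor_lift_hom[OF tensor_swap_bilinear[OF assms]])

lemma tensor_swap_pure:
  assumes "module R V" "module R W" "v \<in> carrier V" "w \<in> carrier W"
  shows "tensor_swap R V W (pure_tensor R V W v w) = pure_tensor R W V w v"
  unfolding tensor_swap_def
  by (rule tensor_lift_pure[OF tensor_swap_bilinear[OF assms(1,2)] assms(3,4)])

text \<open>Needed for \<open>tensor_assoc\<close>, a lift whose values are again lifts. Linearity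
  in \<open>u\<close> at a fixed tensor \<open>X\<close> is an equation between maps linear in
  \<open>X\<close>, so it can be tested on pure tensors.\<close>

lemma tensor_lift_bilinear:
  assumes \<beta>: "\<And>u. u \<in> carrier U \<Longrightarrow> bilinear_map R V W P (\<beta> u)"
    and hom: "\<And>v w. \<lbrakk>v \<in> carrier V; w \<in> carrier W\<rbrakk> \<Longrightarrow> mod_hom R U P (\<lambda>u. \<beta> u v w)"
    and U: "module R U" and V: "module R V" and W: "module R W" and P: "module R P"
  shows "bilinear_map R U (tensor R V W) P (\<lambda>u. tensor_lift R V W P (\<beta> u))"
proof (rule bilinear_mapI[OF U tensor_module[OF V W] P])
  interpret U: module R U by fact
  interpret P: module R P by fact
  have lift: "mod_hom R (tensor R V W) P (tensor_lift R V W P (\<beta> u))" if "u \<in> carrier U" for u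
    using that by (intro tensor_lift_hom \<beta>)
  then show "mod_hom R (tensor R V W) P (tensor_lift R V W P (\<beta> u))" if "u \<in> carrier U" for u
    using that .
  fix X
  assume X: "X \<in> carrier (tensor R V W)"
  show "mod_hom R U P (\<lambda>u. tensor_lift R V W P (\<beta> u) X)"
  proof (rule mod_homI[OF U P])
    show "tensor_lift R V W P (\<beta> u) X \<in> carrier P" if "u \<in> carrier U" for u
      using mod_homD(3)[OF lift[OF that] X] .
    show "tensor_lift R V W P (\<beta> (u \<oplus>\<^bsub>U\<^esub> u')) X =
        tensor_lift R V W P (\<beta> u) X \<oplus>\<^bsub>P\<^esub> tensor_lift R V W P (\<beta> u') X"
      if u: "u \<in> carrier U" and u': "u' \<in> carrier U" for u u'
    proof (rule tensor_ext[OF V W _ _ _ X])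
      show "mod_hom R (tensor R V W) P
          (\<lambda>X. tensor_lift R V W P (\<beta> u) X \<oplus>\<^bsub>P\<^esub> tensor_lift R V W P (\<beta> u') X)"
        using u u' by (intro mod_hom_plus lift)
    qed (use u u' in \<open>simp_all add: lift tensor_lift_pure \<beta> mod_homD(4)[OF hom]\<close>)
    show "tensor_lift R V W P (\<beta> (a \<odot>\<^bsub>U\<^esub> u)) X = a \<odot>\<^bsub>P\<^esub> tensor_lift R V W P (\<beta> u) X"
      if a: "a \<in> carrier R" and u: "u \<in> carrier U" for a u
    proof (rule tensor_ext[OF V W _ _ _ X])
      \<comment> \<open>Multiplication by a scalar is itself linear because the ring is
        commutative.\<close>
      have "mod_hom R P P (\<lambda>x. a \<odot>\<^bsub>P\<^esub> x)"
        using a by (intro mod_homI)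
          (simp_all add: P.module_axioms P.smult_r_distr P.smult_assoc1[symmetric] m_comm)
      then show "mod_hom R (tensor R V W) P (\<lambda>X. a \<odot>\<^bsub>P\<^esub> tensor_lift R V W P (\<beta> u) X)"
        by (rule mod_hom_comp[OF lift[OF u]])
    qed (use a u in \<open>simp_all add: lift tensor_lift_pure \<beta> mod_homD(5)[OF hom]\<close>)
  qed
qed

lemma tensor_assoc_bilinear:
  assumes U: "module R U" and V: "module R V" and W: "module R W"
  shows "u \<in> carrier U \<Longrightarrow> bilinear_map R V W (tensor R (tensor R U V) W)
      (\<lambda>v w. pure_tensor R (tensor R U V) W (pure_tensor R U V u v) w)"
    and "bilinear_map R U (tensor R V W) (tensor R (tensor R U V) W)
      (\<lambda>u. tensor_lift R V W (tensor R (tensor R U V) W)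
        (\<lambda>v w. pure_tensor R (tensor R U V) W (pure_tensor R U V u v) w))"
proof -
  show *: "bilinear_map R V W (tensor R (tensor R U V) W)
      (\<lambda>v w. pure_tensor R (tensor R U V) W (pure_tensor R U V u v) w)" if "u \<in> carrier U" for u
    using that assms
    by (intro bilinear_mapI pure_hom_left pure_hom_right tensor_module mod_hom_ident
        pure_tensor_closed)
  show "bilinear_map R U (tensor R V W) (tensor R (tensor R U V) W)
      (\<lambda>u. tensor_lift R V W (tensor R (tensor R U V) W)
        (\<lambda>v w. pure_tensor R (tensor R U V) W (pure_tensor R U V u v) w))"
    using assms
    by (intro tensor_lift_bilinear * tensor_module pure_hom_left mod_hom_ident)
qed

lemma tensor_assoc_hom:
  assumes "module R U" "module R V" "module R W"
  shows "mod_hom R (tensor R U (tensor R V W)) (tensor R (tensor R U V) W) (tensor_assoc R U V W)"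
  unfolding tensor_assoc_def by (rule tensor_lift_hom[OF tensor_assoc_bilinear(2)[OF assms]])

lemma tensor_assoc_pure:
  assumes "module R U" "module R V" "module R W" "u \<in> carrier U" "v \<in> carrier V" "w \<in> carrier W"
  shows "tensor_assoc R U V W (pure_tensor R U (tensor R V W) u (pure_tensor R V W v w)) =
    pure_tensor R (tensor R U V) W (pure_tensor R U V u v) w"
  unfolding tensor_assoc_def using assms
  by (simp add: tensor_lift_pure[OF tensor_assoc_bilinear(2)]
      tensor_lift_pure[OF tensor_assoc_bilinear(1)] pure_tensor_closed)

text \<open>\<open>tensor_ext\<close> is used twice: for fixed \<open>u\<close>, both maps composed
  with \<open>Y \<mapsto> u \<otimes> Y\<close> are linear on the inner tensor product.\<close>

lemma tensor_ext_assoc: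
  assumes U: "module R U" and V: "module R V" and W: "module R W"
    and f: "mod_hom R (tensor R U (tensor R V W)) P f"
    and g: "mod_hom R (tensor R U (tensor R V W)) P g"
    and eq: "\<And>u v w. \<lbrakk>u \<in> carrier U; v \<in> carrier V; w \<in> carrier W\<rbrakk> \<Longrightarrow>
      f (pure_tensor R U (tensor R V W) u (pure_tensor R V W v w)) =
      g (pure_tensor R U (tensor R V W) u (pure_tensor R V W v w))"
    and X: "X \<in> carrier (tensor R U (tensor R V W))"
  shows "f X = g X"
proof (rule tensor_ext[OF U tensor_module[OF V W] f g _ X])
  fix u Y
  assume u: "u \<in> carrier U" and Y: "Y \<in> carrier (tensor R V W)"
  have pure: "mod_hom R (tensor R V W) (tensor R U (tensor R V W))
      (\<lambda>Y. pure_tensor R U (tensor R V W) u Y)"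
    using assms u by (intro pure_hom_right mod_hom_ident tensor_module)
  show "f (pure_tensor R U (tensor R V W) u Y) = g (pure_tensor R U (tensor R V W) u Y)"
    by (rule tensor_ext[OF V W mod_hom_comp[OF pure f] mod_hom_comp[OF pure g] _ Y])
      (rule eq[OF u])
qed

text \<open>
  Backward application of \<open>mod_hom_comp\<close> leaves the intermediate space and the splitting of the
  composite open; in these instances both are read off the outermost map.
\<close>

lemma tensor_map_comp_hom:
  assumes "mod_hom R U (tensor R V W) h" "mod_hom R V V' f" "mod_hom R W W' g"
  shows "mod_hom R U (tensor R V' W') (\<lambda>x. tensor_map R V W V' W' f g (h x))"
  by (rule mod_hom_comp[OF assms(1) tensor_map_hom[OF assms(2,3)]])

lemma tensor_swap_comp_hom:
  assumes "mod_hom R U (tensor R V W) h" "module R V" "module R W"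
  shows "mod_hom R U (tensor R W V) (\<lambda>x. tensor_swap R V W (h x))"
  by (rule mod_hom_comp[OF assms(1) tensor_swap_hom[OF assms(2,3)]])

lemma tensor_assoc_comp_hom:
  assumes "mod_hom R X (tensor R U (tensor R V W)) h" "module R U" "module R V" "module R W"
  shows "mod_hom R X (tensor R (tensor R U V) W) (\<lambda>x. tensor_assoc R U V W (h x))"
  by (rule mod_hom_comp[OF assms(1) tensor_assoc_hom[OF assms(2-4)]])

section \<open>Composition, additivity and naturality of induced maps\<close>

lemma tensor_map_comp:
  assumes f: "mod_hom R V V' f" and g: "mod_hom R W W' g"
    and f': "mod_hom R V' V'' f'" and g': "mod_hom R W' W'' g'"
    and x: "x \<in> carrier (tensor R V W)"
  shows "tensor_map R V' W' V'' W'' f' g' (tensor_map R V W V' W' f g x) =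
    tensor_map R V W V'' W'' (\<lambda>v. f' (f v)) (\<lambda>w. g' (g w)) x"
  by (rule tensor_ext[OF mod_homD(1)[OF f] mod_homD(1)[OF g]
        mod_hom_comp[OF tensor_map_hom[OF f g] tensor_map_hom[OF f' g']]
        tensor_map_hom[OF mod_hom_comp[OF f f'] mod_hom_comp[OF g g']] _ x])
    (simp add: tensor_map_pure[OF f g] tensor_map_pure[OF f' g'] mod_homD(3)[OF f] mod_homD(3)[OF g]
      tensor_map_pure[OF mod_hom_comp[OF f f'] mod_hom_comp[OF g g']])

lemma tensor_map_cong:
  assumes f: "mod_hom R V V' f" and g: "mod_hom R W W' g"
    and f': "mod_hom R V V' f'" and g': "mod_hom R W W' g'"
    and eq: "\<And>v. v \<in> carrier V \<Longrightarrow> f v = f' v" "\<And>w. w \<in> carrier W \<Longrightarrow> g w = g' w"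
    and x: "x \<in> carrier (tensor R V W)"
  shows "tensor_map R V W V' W' f g x = tensor_map R V W V' W' f' g' x"
  by (rule tensor_ext[OF mod_homD(1)[OF f] mod_homD(1)[OF g]
        tensor_map_hom[OF f g] tensor_map_hom[OF f' g'] _ x])
    (simp add: tensor_map_pure[OF f g] tensor_map_pure[OF f' g'] eq)

lemma tensor_map_add_left:
  assumes f: "mod_hom R V V' f" and f': "mod_hom R V V' f'" and g: "mod_hom R W W' g"
    and x: "x \<in> carrier (tensor R V W)"
  shows "tensor_map R V W V' W' (\<lambda>v. f v \<oplus>\<^bsub>V'\<^esub> f' v) g x =
    tensor_map R V W V' W' f g x \<oplus>\<^bsub>tensor R V' W'\<^esub> tensor_map R V W V' W' f' g x"
proof (rule tensor_ext[OF mod_homD(1)[OF f] mod_homD(1)[OF g] _ _ _ x])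
  note ff' = mod_hom_plus[OF f f']
  show "mod_hom R (tensor R V W) (tensor R V' W')
      (tensor_map R V W V' W' (\<lambda>v. f v \<oplus>\<^bsub>V'\<^esub> f' v) g)"
    by (rule tensor_map_hom[OF ff' g])
  show "mod_hom R (tensor R V W) (tensor R V' W') (\<lambda>x. tensor_map R V W V' W' f g x
      \<oplus>\<^bsub>tensor R V' W'\<^esub> tensor_map R V W V' W' f' g x)"
    by (intro mod_hom_plus tensor_map_hom f f' g)
  fix v w
  assume "v \<in> carrier V" "w \<in> carrier W"
  then show "tensor_map R V W V' W' (\<lambda>v. f v \<oplus>\<^bsub>V'\<^esub> f' v) g (pure_tensor R V W v w) =
      tensor_map R V W V' W' f g (pure_tensor R V W v w)
      \<oplus>\<^bsub>tensor R V' W'\<^esub> tensor_map R V W V' W' f' g (pure_tensor R V W v w)"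
    by (simp add: tensor_map_pure[OF ff' g] tensor_map_pure[OF f g] tensor_map_pure[OF f' g]
        pure_tensor_add_left mod_homD(2,3)[OF f] mod_homD(2,3)[OF g] mod_homD(3)[OF f'])
qed

lemma tensor_map_add_right:
  assumes f: "mod_hom R V V' f" and g: "mod_hom R W W' g" and g': "mod_hom R W W' g'"
    and x: "x \<in> carrier (tensor R V W)"
  shows "tensor_map R V W V' W' f (\<lambda>w. g w \<oplus>\<^bsub>W'\<^esub> g' w) x =
    tensor_map R V W V' W' f g x \<oplus>\<^bsub>tensor R V' W'\<^esub> tensor_map R V W V' W' f g' x"
proof (rule tensor_ext[OF mod_homD(1)[OF f] mod_homD(1)[OF g] _ _ _ x])
  note gg' = mod_hom_plus[OF g g']
  show "mod_hom R (tensor R V W) (tensor R V' W')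
      (tensor_map R V W V' W' f (\<lambda>w. g w \<oplus>\<^bsub>W'\<^esub> g' w))"
    by (rule tensor_map_hom[OF f gg'])
  show "mod_hom R (tensor R V W) (tensor R V' W') (\<lambda>x. tensor_map R V W V' W' f g x
      \<oplus>\<^bsub>tensor R V' W'\<^esub> tensor_map R V W V' W' f g' x)"
    by (intro mod_hom_plus tensor_map_hom f g g')
  fix v w
  assume "v \<in> carrier V" "w \<in> carrier W"
  then show "tensor_map R V W V' W' f (\<lambda>w. g w \<oplus>\<^bsub>W'\<^esub> g' w) (pure_tensor R V W v w) =
      tensor_map R V W V' W' f g (pure_tensor R V W v w)
      \<oplus>\<^bsub>tensor R V' W'\<^esub> tensor_map R V W V' W' f g' (pure_tensor R V W v w)"
    by (simp add: tensor_map_pure[OF f gg'] tensor_map_pure[OF f g] tensor_map_pure[OF f g']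
        pure_tensor_add_right mod_homD(2,3)[OF f] mod_homD(2,3)[OF g] mod_homD(3)[OF g'])
qed

text \<open>Lets operators on the three factors pass through the rebracketing that is suppressed in
  the usual notation.\<close>

lemma tensor_assoc_natural:
  assumes f: "mod_hom R U U' f" and g: "mod_hom R V V' g" and h: "mod_hom R W W' h"
    and x: "x \<in> carrier (tensor R U (tensor R V W))"
  shows "tensor_assoc R U' V' W'
      (tensor_map R U (tensor R V W) U' (tensor R V' W') f (tensor_map R V W V' W' g h) x) =
    tensor_map R (tensor R U V) W (tensor R U' V') W' (tensor_map R U V U' V' f g) h
      (tensor_assoc R U V W x)"
proof (rule tensor_ext_assoc[OF mod_homD(1)[OF f] mod_homD(1)[OF g] mod_homD(1)[OF h] _ _ _ x])
  note mods [simp] = mod_homD(1,2)[OF f] mod_homD(1,2)[OF g] mod_homD(1,2)[OF h]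
  note gh = tensor_map_hom[OF g h] and fg = tensor_map_hom[OF f g]
  show "mod_hom R (tensor R U (tensor R V W)) (tensor R (tensor R U' V') W')
      (\<lambda>x. tensor_assoc R U' V' W'
        (tensor_map R U (tensor R V W) U' (tensor R V' W') f (tensor_map R V W V' W' g h) x))"
    by (intro tensor_assoc_comp_hom tensor_map_hom f gh mods)
  show "mod_hom R (tensor R U (tensor R V W)) (tensor R (tensor R U' V') W')
      (\<lambda>x. tensor_map R (tensor R U V) W (tensor R U' V') W' (tensor_map R U V U' V' f g) h
        (tensor_assoc R U V W x))"
    by (intro tensor_map_comp_hom tensor_assoc_hom fg h mods)
  fix u v w
  assume "u \<in> carrier U" "v \<in> carrier V" "w \<in> carrier W"
  then show "tensor_assoc R U' V' W' (tensor_map R U (tensor R V W) U' (tensor R V' W') f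
        (tensor_map R V W V' W' g h) (pure_tensor R U (tensor R V W) u (pure_tensor R V W v w))) =
      tensor_map R (tensor R U V) W (tensor R U' V') W' (tensor_map R U V U' V' f g) h
        (tensor_assoc R U V W (pure_tensor R U (tensor R V W) u (pure_tensor R V W v w)))"
    by (simp add: tensor_map_pure[OF f gh] tensor_map_pure[OF fg h] tensor_map_pure[OF g h]
        tensor_map_pure[OF f g] tensor_assoc_pure pure_tensor_closed
        mod_homD(3)[OF f] mod_homD(3)[OF g] mod_homD(3)[OF h])
qed

lemma tensor_swap_natural:
  assumes f: "mod_hom R V V' f" and g: "mod_hom R W W' g" and x: "x \<in> carrier (tensor R V W)"
  shows "tensor_swap R V' W' (tensor_map R V W V' W' f g x) =
    tensor_map R W V W' V' g f (tensor_swap R V W x)"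
proof (rule tensor_ext[OF mod_homD(1)[OF f] mod_homD(1)[OF g] _ _ _ x])
  note mods [simp] = mod_homD(1,2)[OF f] mod_homD(1,2)[OF g]
  show "mod_hom R (tensor R V W) (tensor R W' V')
      (\<lambda>x. tensor_swap R V' W' (tensor_map R V W V' W' f g x))"
    by (intro tensor_swap_comp_hom tensor_map_hom f g mods)
  show "mod_hom R (tensor R V W) (tensor R W' V')
      (\<lambda>x. tensor_map R W V W' V' g f (tensor_swap R V W x))"
    by (intro tensor_map_comp_hom tensor_swap_hom f g mods)
qed (simp add: tensor_map_pure[OF f g] tensor_map_pure[OF g f] tensor_swap_pure
      mod_homD[OF f] mod_homD[OF g])

end

section \<open>Alternation of the first two tensor factors\<close>

lemma (in abelian_group) minus_minus_left:
  "\<lbrakk>a \<in> carrier G; b \<in> carrier G; c \<in> carrier G\<rbrakk> \<Longrightarrow> a \<ominus> b \<ominus> c = a \<ominus> (b \<oplus> c)"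
  by (simp add: a_minus_def minus_add a_assoc)

lemma (in abelian_group) minus_minus_right:
  "\<lbrakk>a \<in> carrier G; b \<in> carrier G; c \<in> carrier G\<rbrakk> \<Longrightarrow> a \<ominus> (b \<ominus> c) = (a \<oplus> c) \<ominus> b"
  by (simp add: a_minus_def minus_add a_ac)

lemma (in abelian_group) minus_add_left:
  "\<lbrakk>a \<in> carrier G; b \<in> carrier G; c \<in> carrier G\<rbrakk> \<Longrightarrow> (a \<ominus> b) \<oplus> c = (a \<oplus> c) \<ominus> b"
  by (simp add: a_minus_def a_ac)

lemma (in abelian_group) minus_add_right:
  "\<lbrakk>a \<in> carrier G; b \<in> carrier G; c \<in> carrier G\<rbrakk> \<Longrightarrow> a \<oplus> (b \<ominus> c) = (a \<oplus> b) \<ominus> c"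
  by (simp add: a_minus_def a_ac)

text \<open>A signed sum becomes one difference of two sums, and an equation of two differences
  becomes an equation of sums. Cancellation between permuted tensors is then a matter of
  commutativity alone.\<close>

lemmas (in abelian_group) minus_normalize =
  minus_minus_left minus_minus_right minus_add_left minus_add_right minus_eq_minus_iff

definition alternation ::
  "('k, 'r) ring_scheme \<Rightarrow> ('k, 'c, 'x) module_scheme \<Rightarrow> ('c \<times> 'c \<Rightarrow> 'k) set \<Rightarrow> ('c \<times> 'c \<Rightarrow> 'k) set"
  where "alternation K C z = z \<ominus>\<^bsub>tensor K C C\<^esub> tensor_swap K C C z"

text \<open>The map \<open>A \<otimes> id\<close>, written through the swap rather than as a
  \<open>tensor_map\<close> of \<open>alternation\<close>, so that the pre-Lie conditions are
  literally its vanishing on the associators.\<close>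

definition alternation_left ::
  "('k, 'r) ring_scheme \<Rightarrow> ('k, 'c, 'x) module_scheme \<Rightarrow> ('k, 'm, 'y) module_scheme
    \<Rightarrow> (('c \<times> 'c \<Rightarrow> 'k) set \<times> 'm \<Rightarrow> 'k) set \<Rightarrow> (('c \<times> 'c \<Rightarrow> 'k) set \<times> 'm \<Rightarrow> 'k) set"
  where "alternation_left K C M X = X \<ominus>\<^bsub>tensor K (tensor K C C) M\<^esub>
    tensor_map K (tensor K C C) M (tensor K C C) M (tensor_swap K C C) id X"

context cring
begin

lemma alternation_hom:
  "module R C \<Longrightarrow> mod_hom R (tensor R C C) (tensor R C C) (alternation R C)"
  unfolding alternation_def by (intro mod_hom_minus mod_hom_ident tensor_swap_hom tensor_module)

lemma alternation_comp_hom: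
  assumes "mod_hom R U (tensor R C C) f" "module R C"
  shows "mod_hom R U (tensor R C C) (\<lambda>x. alternation R C (f x))"
  by (rule mod_hom_comp[OF assms(1) alternation_hom[OF assms(2)]])

lemma alternation_left_hom:
  assumes "module R C" "module R M"
  shows "mod_hom R (tensor R (tensor R C C) M) (tensor R (tensor R C C) M) (alternation_left R C M)"
  unfolding alternation_left_def using assms
  by (intro mod_hom_minus mod_hom_ident tensor_map_hom tensor_swap_hom tensor_module mod_hom_id)

text \<open>Connects that form with \<open>A\<close> itself: alternating after
  \<open>f \<otimes> g\<close> is the same as replacing \<open>f\<close> by
  \<open>A f\<close>.\<close>

lemma alternation_left_map:
  assumes f: "mod_hom R U (tensor R C C) f" and g: "mod_hom R V M g" and C: "module R C"
    and x: "x \<in> carrier (tensor R U V)"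
  shows "alternation_left R C M (tensor_map R U V (tensor R C C) M f g x) =
    tensor_map R U V (tensor R C C) M (\<lambda>u. alternation R C (f u)) g x"
proof (rule tensor_ext[OF mod_homD(1)[OF f] mod_homD(1)[OF g] _ _ _ x])
  note M = mod_homD(2)[OF g]
  note swap = tensor_swap_hom[OF C C]
  have af: "mod_hom R U (tensor R C C) (\<lambda>u. alternation R C (f u))"
    using f C by (rule alternation_comp_hom)
  show "mod_hom R (tensor R U V) (tensor R (tensor R C C) M)
      (\<lambda>x. alternation_left R C M (tensor_map R U V (tensor R C C) M f g x))"
    by (rule mod_hom_comp[OF tensor_map_hom[OF f g] alternation_left_hom[OF C M]])
  show "mod_hom R (tensor R U V) (tensor R (tensor R C C) M)
      (tensor_map R U V (tensor R C C) M (\<lambda>u. alternation R C (f u)) g)"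
    by (rule tensor_map_hom[OF af g])
  fix u v
  assume "u \<in> carrier U" "v \<in> carrier V"
  then show "alternation_left R C M (tensor_map R U V (tensor R C C) M f g (pure_tensor R U V u v)) =
      tensor_map R U V (tensor R C C) M (\<lambda>u. alternation R C (f u)) g (pure_tensor R U V u v)"
    by (simp add: tensor_map_pure[OF f g] tensor_map_pure[OF af[unfolded alternation_def] g]
        alternation_left_def alternation_def tensor_map_pure[OF swap mod_hom_id[OF M]]
        pure_tensor_minus_left tensor_module C M mod_homD(3)[OF f] mod_homD(3)[OF g]
        mod_homD(3)[OF swap])
qed

text \<open>Only \<open>A f\<close> enters, so \<open>f\<close> may be exchanged for any map that
  agrees with it modulo the kernel of \<open>A\<close>. This is how identities known only after
  alternation are used inside a threefold tensor.\<close>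

lemma alternation_left_map_cong:
  assumes f: "mod_hom R U (tensor R C C) f" and f': "mod_hom R U (tensor R C C) f'"
    and g: "mod_hom R V M g" and C: "module R C"
    and eq: "\<And>u. u \<in> carrier U \<Longrightarrow> alternation R C (f u) = alternation R C (f' u)"
    and x: "x \<in> carrier (tensor R U V)"
  shows "alternation_left R C M (tensor_map R U V (tensor R C C) M f g x) =
    alternation_left R C M (tensor_map R U V (tensor R C C) M f' g x)"
  unfolding alternation_left_map[OF f g C x] alternation_left_map[OF f' g C x]
  by (intro tensor_map_cong alternation_comp_hom f f' g C eq x refl)

text \<open>The swap commutes with \<open>f \<otimes> f\<close> because both slots carry the same
  map; hence \<open>Q \<otimes> Q \<otimes> id\<close> can later be pulled out of the
  alternation.\<close>

lemma alternation_left_natural: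
  assumes f: "mod_hom R C C f" and g: "mod_hom R M M' g"
    and X: "X \<in> carrier (tensor R (tensor R C C) M)"
  shows "alternation_left R C M' (tensor_map R (tensor R C C) M (tensor R C C) M'
      (tensor_map R C C C C f f) g X) =
    tensor_map R (tensor R C C) M (tensor R C C) M' (tensor_map R C C C C f f) g
      (alternation_left R C M X)"
proof -
  note C = mod_homD(1)[OF f] and M = mod_homD(1)[OF g]
  note swap = tensor_swap_hom[OF C C] and ff = tensor_map_hom[OF f f] and id = mod_hom_id[OF M]
    and id' = mod_hom_id[OF mod_homD(2)[OF g]]
  have "tensor_map R (tensor R C C) M' (tensor R C C) M' (tensor_swap R C C) id
      (tensor_map R (tensor R C C) M (tensor R C C) M' (tensor_map R C C C C f f) g X) =
    tensor_map R (tensor R C C) M (tensor R C C) M'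
      (\<lambda>z. tensor_swap R C C (tensor_map R C C C C f f z)) (\<lambda>m. id (g m)) X"
    by (rule tensor_map_comp[OF ff g swap id' X])
  also have "\<dots> = tensor_map R (tensor R C C) M (tensor R C C) M'
      (\<lambda>z. tensor_map R C C C C f f (tensor_swap R C C z)) (\<lambda>m. g (id m)) X"
    by (rule tensor_map_cong[OF mod_hom_comp[OF ff swap] mod_hom_comp[OF g id']
          mod_hom_comp[OF swap ff] mod_hom_comp[OF id g] _ _ X])
      (simp_all add: tensor_swap_natural[OF f f])
  also have "\<dots> = tensor_map R (tensor R C C) M (tensor R C C) M' (tensor_map R C C C C f f) g
      (tensor_map R (tensor R C C) M (tensor R C C) M (tensor_swap R C C) id X)"
    by (rule tensor_map_comp[OF swap id ff g X, symmetric])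
  finally show ?thesis
    using X by (simp add: alternation_left_def mod_homD(7)[OF tensor_map_hom[OF ff g]]
        mod_homD(3)[OF tensor_map_hom[OF swap id]])
qed

text \<open>The subtracted term \<open>Q(c\<^sub>2) \<otimes> c\<^sub>1\<close> of the Sweedler
  formula is \<open>Q \<otimes> id\<close> applied after the swap, so both terms combine into
  \<open>(Q \<otimes> id) A\<close>.\<close>

lemma tilde_coproduct_eq:
  assumes Q: "mod_hom R C C Q" and z: "\<Delta> c \<in> carrier (tensor R C C)"
  shows "tilde_coproduct R C \<Delta> Q c = tensor_map R C C C C Q id (alternation R C (\<Delta> c))"
  unfolding tilde_coproduct_def
proof (rule tensor_ext[OF _ _ _ _ _ z])
  show C: "module R C" "module R C"
    using mod_homD(1)[OF Q] by auto
  note C = C(1)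
  note Qi = tensor_map_hom[OF Q mod_hom_id[OF C]]
  have \<beta>: "bilinear_map R C C (tensor R C C)
      (\<lambda>c1 c2. pure_tensor R C C (Q c1) c2 \<ominus>\<^bsub>tensor R C C\<^esub> pure_tensor R C C (Q c2) c1)"
    by (intro bilinear_mapI mod_hom_minus pure_hom_left pure_hom_right mod_hom_ident Q C
        tensor_module mod_homD(3)[OF Q])
  show "mod_hom R (tensor R C C) (tensor R C C) (tensor_lift R C C (tensor R C C)
      (\<lambda>c1 c2. pure_tensor R C C (Q c1) c2 \<ominus>\<^bsub>tensor R C C\<^esub> pure_tensor R C C (Q c2) c1))"
    by (rule tensor_lift_hom[OF \<beta>])
  show "mod_hom R (tensor R C C) (tensor R C C) (\<lambda>z. tensor_map R C C C C Q id (alternation R C z))"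
    by (rule mod_hom_comp[OF alternation_hom[OF C] Qi])
  fix a b
  assume "a \<in> carrier C" "b \<in> carrier C"
  then show "tensor_lift R C C (tensor R C C)
        (\<lambda>c1 c2. pure_tensor R C C (Q c1) c2 \<ominus>\<^bsub>tensor R C C\<^esub> pure_tensor R C C (Q c2) c1)
        (pure_tensor R C C a b) =
      tensor_map R C C C C Q id (alternation R C (pure_tensor R C C a b))"
    by (simp add: tensor_lift_pure[OF \<beta>] alternation_def tensor_swap_pure C pure_tensor_closed
        mod_homD(7)[OF Qi] tensor_map_pure[OF Q mod_hom_id[OF C]])
qed

lemma tilde_coaction_eq:
  assumes Q: "mod_hom R C C Q" and T: "mod_hom R M M T" and z: "\<rho> m \<in> carrier (tensor R C M)"
  shows "tilde_coaction R C M \<rho> Q T m =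
    tensor_map R C M C M Q id (\<rho> m) \<oplus>\<^bsub>tensor R C M\<^esub> tensor_map R C M C M id T (\<rho> m)"
  unfolding tilde_coaction_def
proof (rule tensor_ext[OF _ _ _ _ _ z])
  show C: "module R C" and M: "module R M"
    using mod_homD(1)[OF Q] mod_homD(1)[OF T] by auto
  note id = mod_hom_id[OF C] mod_hom_id[OF M]
  have \<beta>: "bilinear_map R C M (tensor R C M)
      (\<lambda>a n. pure_tensor R C M (Q a) n \<oplus>\<^bsub>tensor R C M\<^esub> pure_tensor R C M a (T n))"
    by (intro bilinear_mapI mod_hom_plus pure_hom_left pure_hom_right mod_hom_ident Q T C M
        tensor_module mod_homD(3)[OF Q] mod_homD(3)[OF T])
  show "mod_hom R (tensor R C M) (tensor R C M) (tensor_lift R C M (tensor R C M)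
      (\<lambda>a n. pure_tensor R C M (Q a) n \<oplus>\<^bsub>tensor R C M\<^esub> pure_tensor R C M a (T n)))"
    by (rule tensor_lift_hom[OF \<beta>])
  show "mod_hom R (tensor R C M) (tensor R C M) (\<lambda>z. tensor_map R C M C M Q id z
      \<oplus>\<^bsub>tensor R C M\<^esub> tensor_map R C M C M id T z)"
    by (intro mod_hom_plus tensor_map_hom Q T id)
  fix a n
  assume "a \<in> carrier C" "n \<in> carrier M"
  then show "tensor_lift R C M (tensor R C M)
        (\<lambda>a n. pure_tensor R C M (Q a) n \<oplus>\<^bsub>tensor R C M\<^esub> pure_tensor R C M a (T n))
        (pure_tensor R C M a n) =
      tensor_map R C M C M Q id (pure_tensor R C M a n) \<oplus>\<^bsub>tensor R C M\<^esub>
      tensor_map R C M C M id T (pure_tensor R C M a n)"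
    by (simp add: tensor_lift_pure[OF \<beta>] tensor_map_pure[OF Q id(2)] tensor_map_pure[OF id(1) T])
qed

text \<open>On \<open>a \<otimes> b\<close> both sides are \<open>Q a \<otimes> b - b \<otimes> Q a
  - Q b \<otimes> a + a \<otimes> Q b\<close>. The right side has the shape of the Rota-Baxter
  identity, which the left side has not.\<close>

lemma alternation_map_alternation:
  assumes Q: "mod_hom R C C Q" and z: "z \<in> carrier (tensor R C C)"
  shows "alternation R C (tensor_map R C C C C Q id (alternation R C z)) =
    alternation R C (tensor_map R C C C C Q id z \<oplus>\<^bsub>tensor R C C\<^esub> tensor_map R C C C C id Q z)"
proof (rule tensor_ext[OF _ _ _ _ _ z])
  show C: "module R C" "module R C"
    using mod_homD(1)[OF Q] by auto
  note C = C(1)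
  note id = mod_hom_id[OF C]
  note Qi = tensor_map_hom[OF Q id] and iQ = tensor_map_hom[OF id Q]
    and swap = tensor_swap_hom[OF C C]
  interpret CC: module R "tensor R C C" by (rule tensor_module[OF C C])
  show "mod_hom R (tensor R C C) (tensor R C C)
      (\<lambda>z. alternation R C (tensor_map R C C C C Q id (alternation R C z)))"
    by (intro alternation_comp_hom tensor_map_comp_hom alternation_hom Q id C)
  show "mod_hom R (tensor R C C) (tensor R C C) (\<lambda>z. alternation R C
      (tensor_map R C C C C Q id z \<oplus>\<^bsub>tensor R C C\<^esub> tensor_map R C C C C id Q z))"
    by (intro alternation_comp_hom mod_hom_plus Qi iQ C)
  fix a b
  assume ab: "a \<in> carrier C" "b \<in> carrier C"
  then show "alternation R C (tensor_map R C C C C Q id (alternation R C (pure_tensor R C C a b))) =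
      alternation R C (tensor_map R C C C C Q id (pure_tensor R C C a b) \<oplus>\<^bsub>tensor R C C\<^esub>
        tensor_map R C C C C id Q (pure_tensor R C C a b))"
    by (simp add: alternation_def mod_homD(4,7)[OF Qi] mod_homD(4,7)[OF swap]
        tensor_map_pure[OF Q id] tensor_map_pure[OF id Q] tensor_swap_pure C pure_tensor_closed
        mod_homD(3)[OF Q] CC.minus_normalize CC.a_ac)
qed

text \<open>Write \<open>abc\<close> for \<open>a \<otimes> b \<otimes> c\<close>. On the left,
  \<open>id \<otimes> A\<close> sends \<open>abc - cab\<close> to
  \<open>abc - acb - cab + cba\<close>; the part \<open>- acb - cab\<close> is symmetric in the
  first two slots and dies under alternation. What is left, \<open>abc + cba\<close>, has the same
  alternation as \<open>abc - bca\<close> on the right, since \<open>cba + bca\<close> is symmetric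
  as well.\<close>

lemma alternation_assoc_cyclic:
  assumes C: "module R C" and Y: "Y \<in> carrier (tensor R C (tensor R C C))"
  shows "alternation_left R C C (tensor_assoc R C C C (tensor_map R C (tensor R C C) C (tensor R C C)
      id (alternation R C)
      (Y \<ominus>\<^bsub>tensor R C (tensor R C C)\<^esub> tensor_swap R (tensor R C C) C (tensor_assoc R C C C Y)))) =
    alternation_left R C C (tensor_assoc R C C C Y
      \<ominus>\<^bsub>tensor R (tensor R C C) C\<^esub> tensor_swap R C (tensor R C C) Y)"
proof (rule tensor_ext_assoc[OF C C C _ _ _ Y])
  note CC = tensor_module[OF C C] and id = mod_hom_id[OF C]
  note alt = alternation_hom[OF C]
  note assoc = tensor_assoc_hom[OF C C C] and swap = tensor_swap_hom[OF C C]
    and swap3 = tensor_swap_hom[OF CC C] and swap3' = tensor_swap_hom[OF C CC]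
  note alt3 = alternation_left_hom[OF C C] and idalt = tensor_map_hom[OF id alt]
    and \<sigma> = tensor_map_hom[OF swap id]
  interpret T: module R "tensor R (tensor R C C) C" by (rule tensor_module[OF CC C])
  interpret T': module R "tensor R C (tensor R C C)" by (rule tensor_module[OF C CC])
  have dif: "mod_hom R (tensor R C (tensor R C C)) (tensor R C (tensor R C C)) (\<lambda>Y. Y
      \<ominus>\<^bsub>tensor R C (tensor R C C)\<^esub> tensor_swap R (tensor R C C) C (tensor_assoc R C C C Y))"
    by (intro mod_hom_minus mod_hom_ident tensor_swap_comp_hom assoc C CC T'.module_axioms)
  show "mod_hom R (tensor R C (tensor R C C)) (tensor R (tensor R C C) C)
    (\<lambda>Y. alternation_left R C C (tensor_assoc R C C C
      (tensor_map R C (tensor R C C) C (tensor R C C) id (alternation R C)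
      (Y \<ominus>\<^bsub>tensor R C (tensor R C C)\<^esub> tensor_swap R (tensor R C C) C (tensor_assoc R C C C Y)))))"
    by (rule mod_hom_comp[OF mod_hom_comp[OF mod_hom_comp[OF dif idalt] assoc] alt3])
  show "mod_hom R (tensor R C (tensor R C C)) (tensor R (tensor R C C) C)
    (\<lambda>Y. alternation_left R C C (tensor_assoc R C C C Y
      \<ominus>\<^bsub>tensor R (tensor R C C) C\<^esub> tensor_swap R C (tensor R C C) Y))"
    by (rule mod_hom_comp[OF mod_hom_minus[OF assoc swap3'] alt3])
  fix a b c
  assume abc: "a \<in> carrier C" "b \<in> carrier C" "c \<in> carrier C"
  let ?p = "pure_tensor R C (tensor R C C) a (pure_tensor R C C b c)"
  let ?t = "\<lambda>x y z. pure_tensor R (tensor R C C) C (pure_tensor R C C x y) z"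
  have t [simp]: "?t x y z \<in> carrier (tensor R (tensor R C C) C)"
    if "x \<in> carrier C" "y \<in> carrier C" "z \<in> carrier C" for x y z
    using that by (intro pure_tensor_closed C CC)
  have t' [simp]: "pure_tensor R C (tensor R C C) x (pure_tensor R C C y z)
      \<in> carrier (tensor R C (tensor R C C))"
    if "x \<in> carrier C" "y \<in> carrier C" "z \<in> carrier C" for x y z
    using that by (intro pure_tensor_closed C CC)
  have \<sigma>t [simp]: "tensor_map R (tensor R C C) C (tensor R C C) C (tensor_swap R C C) id (?t x y z) =
      ?t y x z" if "x \<in> carrier C" "y \<in> carrier C" "z \<in> carrier C" for x y z
    using that by (simp add: tensor_map_pure[OF swap id] tensor_swap_pure pure_tensor_closed C)
  have assoc_alt [simp]: "tensor_assoc R C C C (tensor_map R C (tensor R C C) C (tensor R C C) id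
        (alternation R C) (pure_tensor R C (tensor R C C) x (pure_tensor R C C y z))) =
      ?t x y z \<ominus>\<^bsub>tensor R (tensor R C C) C\<^esub> ?t x z y"
    if "x \<in> carrier C" "y \<in> carrier C" "z \<in> carrier C" for x y z
    using that
    by (simp add: tensor_map_pure[OF id alt] alternation_def tensor_swap_pure pure_tensor_closed
        pure_tensor_minus_right C CC mod_homD(7)[OF assoc] tensor_assoc_pure)
  show "alternation_left R C C (tensor_assoc R C C C
      (tensor_map R C (tensor R C C) C (tensor R C C) id (alternation R C)
      (?p \<ominus>\<^bsub>tensor R C (tensor R C C)\<^esub> tensor_swap R (tensor R C C) C (tensor_assoc R C C C ?p)))) =
    alternation_left R C C (tensor_assoc R C C C ?p
      \<ominus>\<^bsub>tensor R (tensor R C C) C\<^esub> tensor_swap R C (tensor R C C) ?p)"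
    using abc
    by (simp add: tensor_assoc_pure tensor_swap_pure C CC pure_tensor_closed
        mod_homD(7)[OF idalt] mod_homD(3)[OF idalt] mod_homD(7)[OF assoc] mod_homD(4,7)[OF \<sigma>]
        alternation_left_def T.minus_normalize T.a_ac)
qed

end

section \<open>Pre-Lie structures from Rota-Baxter operators\<close>

text \<open>The closed forms of \<open>\<Delta>~\<close> and \<open>\<rho>~\<close> are known only
  for arguments in the carrier, so linearity is transferred along equality there.\<close>

lemma mod_hom_cong:
  assumes "mod_hom R V W g" "\<And>v. v \<in> carrier V \<Longrightarrow> f v = g v"
  shows "mod_hom R V W f"
proof -
  interpret V: module R V by (rule mod_homD(1)[OF assms(1)])
  show ?thesis
    by (rule mod_homI) (simp_all add: assms(2) mod_homD[OF assms(1)])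
qed

context cring
begin

context
  fixes C and \<Delta> and Q
  assumes \<Delta>: "mod_hom R C (tensor R C C) \<Delta>" and Q: "mod_hom R C C Q"
begin

private lemma C: "module R C"
  by (rule mod_homD(1)[OF Q])

private lemma idC: "mod_hom R C C id"
  by (rule mod_hom_id[OF C])

private lemmas Qi = tensor_map_hom[OF Q idC] and iQ = tensor_map_hom[OF idC Q]
  and QQ = tensor_map_hom[OF Q Q] and alt = alternation_hom[OF C]

lemma tilde_coproduct_cong:
  "c \<in> carrier C \<Longrightarrow>
    tilde_coproduct R C \<Delta> Q c = tensor_map R C C C C Q id (alternation R C (\<Delta> c))"
  by (rule tilde_coproduct_eq[OF Q]) (rule mod_homD(3)[OF \<Delta>])

lemma tilde_coproduct_hom: "mod_hom R C (tensor R C C) (tilde_coproduct R C \<Delta> Q)"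
  by (rule mod_hom_cong[OF mod_hom_comp[OF mod_hom_comp[OF \<Delta> alt] Qi] tilde_coproduct_cong])

lemma alternation_tilde_coproduct:
  assumes c: "c \<in> carrier C"
  shows "alternation R C (tilde_coproduct R C \<Delta> Q c) =
    alternation R C (tensor_map R C C C C Q id (\<Delta> c) \<oplus>\<^bsub>tensor R C C\<^esub>
      tensor_map R C C C C id Q (\<Delta> c))"
  unfolding tilde_coproduct_cong[OF c]
  by (rule alternation_map_alternation[OF Q mod_homD(3)[OF \<Delta> c]])

context
  assumes rota_baxter: "\<And>c. c \<in> carrier C \<Longrightarrow> tensor_map R C C C C Q Q (\<Delta> c) =
    tensor_map R C C C C Q id (\<Delta> (Q c)) \<oplus>\<^bsub>tensor R C C\<^esub> tensor_map R C C C C id Q (\<Delta> (Q c))"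
begin

text \<open>At \<open>Q c\<close> the sum produced by \<open>alternation_tilde_coproduct\<close> is
  exactly the right side of the weight 0 Rota-Baxter identity.\<close>

lemma alternation_tilde_coproduct_operator:
  assumes c: "c \<in> carrier C"
  shows "alternation R C (tilde_coproduct R C \<Delta> Q (Q c)) =
    alternation R C (tensor_map R C C C C Q Q (\<Delta> c))"
  using alternation_tilde_coproduct[OF mod_homD(3)[OF Q c]] rota_baxter[OF c] by simp

section \<open>The pre-Lie identity of the coalgebra\<close>

lemma alternation_coassociator:
  assumes coassoc: "\<And>c. c \<in> carrier C \<Longrightarrow>
      tensor_map R C C (tensor R C C) C \<Delta> id (\<Delta> c) =
      tensor_assoc R C C C (tensor_map R C C C (tensor R C C) id \<Delta> (\<Delta> c))"
    and c: "c \<in> carrier C"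
  shows "alternation_left R C C (coassociator R C (tilde_coproduct R C \<Delta> Q) c) =
    \<zero>\<^bsub>tensor R (tensor R C C) C\<^esub>"
proof -
  let ?D = "tilde_coproduct R C \<Delta> Q"
  let ?u = "alternation R C (\<Delta> c)"
  let ?Y = "tensor_map R C C C (tensor R C C) id \<Delta> (\<Delta> c)"
  let ?L = "tensor_map R C C (tensor R C C) C \<Delta> id ?u"
  let ?R = "tensor_assoc R C C C (tensor_map R C (tensor R C C) C (tensor R C C) id
    (alternation R C) (tensor_map R C C C (tensor R C C) id \<Delta> ?u))"
  let ?QQ = "tensor_map R (tensor R C C) C (tensor R C C) C (tensor_map R C C C C Q Q) id"
  note D = tilde_coproduct_hom
  note CC = tensor_module[OF C C]
  note \<Delta>i = tensor_map_hom[OF \<Delta> idC] and i\<Delta> = tensor_map_hom[OF idC \<Delta>]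
    and swap = tensor_swap_hom[OF C C] and assoc = tensor_assoc_hom[OF C C C]
    and ialt = tensor_map_hom[OF idC alt]
    and alt3 = alternation_left_hom[OF C C] and QQi = tensor_map_hom[OF QQ idC]
  interpret CCC: module R "tensor R (tensor R C C) C" by (rule tensor_module[OF CC C])
  have \<Delta>c: "\<Delta> c \<in> carrier (tensor R C C)"
    by (rule mod_homD(3)[OF \<Delta> c])
  have u: "?u \<in> carrier (tensor R C C)"
    by (rule mod_homD(3)[OF alt \<Delta>c])
  have Dc: "?D c = tensor_map R C C C C Q id ?u"
    by (rule tilde_coproduct_cong[OF c])
  have Qu: "tensor_map R C C C C Q id ?u \<in> carrier (tensor R C C)"
    by (rule mod_homD(3)[OF Qi u])

  \<comment> \<open>Since \<open>\<Delta>~ c = (Q \<otimes> id) u\<close> with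
    \<open>u = A \<Delta> c\<close>, the first leg becomes \<open>\<Delta>~ Q\<close>, which under
    alternation may be replaced by \<open>(Q \<otimes> Q) \<Delta>\<close>.\<close>
  have "alternation_left R C C (tensor_map R C C (tensor R C C) C ?D id (?D c)) =
      alternation_left R C C (tensor_map R C C (tensor R C C) C (\<lambda>c. ?D (Q c)) id ?u)"
    using tensor_map_comp[OF Q idC D idC u] by (simp add: Dc id_def)
  also have "\<dots> = alternation_left R C C (tensor_map R C C (tensor R C C) C
      (\<lambda>c. tensor_map R C C C C Q Q (\<Delta> c)) id ?u)"
    by (rule alternation_left_map_cong[OF mod_hom_comp[OF Q D] mod_hom_comp[OF \<Delta> QQ] idC C
          alternation_tilde_coproduct_operator u])
  also have "\<dots> = alternation_left R C C (?QQ ?L)"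
    using tensor_map_comp[OF \<Delta> idC QQ idC u] by (simp add: id_def)
  also have "\<dots> = ?QQ (alternation_left R C C ?L)"
    by (rule alternation_left_natural[OF Q idC mod_homD(3)[OF \<Delta>i u]])
  finally have left: "alternation_left R C C (tensor_map R C C (tensor R C C) C ?D id (?D c)) =
      ?QQ (alternation_left R C C ?L)" .

  \<comment> \<open>Here the two copies of \<open>Q\<close> arise separately: one from the outer
    \<open>\<Delta>~\<close> on the first slot, the other from the inner \<open>\<Delta>~\<close> on
    the second. The inner alternation stays and is part of \<open>?R\<close>.\<close>
  have "tensor_map R C C C (tensor R C C) id ?D (?D c) =
      tensor_map R C C C (tensor R C C) Q ?D ?u"
    using tensor_map_comp[OF Q idC idC D u] by (simp add: Dc id_def)
  also have "\<dots> = tensor_map R C C C (tensor R C C) Q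
      (\<lambda>c. tensor_map R C C C C Q id (alternation R C (\<Delta> c))) ?u"
    by (rule tensor_map_cong[OF Q D Q mod_hom_comp[OF mod_hom_comp[OF \<Delta> alt] Qi]
          refl tilde_coproduct_cong u])
  also have "\<dots> = tensor_map R C (tensor R C C) C (tensor R C C) Q (tensor_map R C C C C Q id)
      (tensor_map R C (tensor R C C) C (tensor R C C) id (alternation R C)
        (tensor_map R C C C (tensor R C C) id \<Delta> ?u))"
    using tensor_map_comp[OF idC \<Delta> idC alt u]
      tensor_map_comp[OF idC mod_hom_comp[OF \<Delta> alt] Q Qi u] by (simp add: id_def)
  finally have "alternation_left R C C (tensor_assoc R C C C
      (tensor_map R C C C (tensor R C C) id ?D (?D c))) = alternation_left R C C (?QQ ?R)"
    using tensor_assoc_natural[OF Q Q idC mod_homD(3)[OF ialt mod_homD(3)[OF i\<Delta> u]]] by simp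
  also have "\<dots> = ?QQ (alternation_left R C C ?R)"
    by (rule alternation_left_natural[OF Q idC mod_homD(3)[OF assoc
            mod_homD(3)[OF ialt mod_homD(3)[OF i\<Delta> u]]]])
  finally have right: "alternation_left R C C (tensor_assoc R C C C
      (tensor_map R C C C (tensor R C C) id ?D (?D c))) = ?QQ (alternation_left R C C ?R)" .

  have Y: "?Y \<in> carrier (tensor R C (tensor R C C))"
    by (rule mod_homD(3)[OF i\<Delta> \<Delta>c])
  have s\<Delta>c: "tensor_swap R C C (\<Delta> c) \<in> carrier (tensor R C C)"
    by (rule mod_homD(3)[OF swap \<Delta>c])
  \<comment> \<open>Moving the coproduct past the swap in \<open>u\<close> exchanges
    \<open>id \<otimes> \<Delta>\<close> and \<open>\<Delta> \<otimes> id\<close>, and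
    coassociativity brings both back to \<open>?Y\<close>. The swapped terms are cyclic shifts of
    \<open>?Y\<close>, in opposite directions for \<open>?R\<close> and \<open>?L\<close>.\<close>
  have "tensor_map R C C C (tensor R C C) id \<Delta> ?u =
      ?Y \<ominus>\<^bsub>tensor R C (tensor R C C)\<^esub> tensor_swap R (tensor R C C) C (tensor_assoc R C C C ?Y)"
    using tensor_swap_natural[OF \<Delta> idC \<Delta>c] coassoc[OF c]
    by (simp add: alternation_def mod_homD(7)[OF i\<Delta> \<Delta>c s\<Delta>c])
  moreover have "?L = tensor_assoc R C C C ?Y
      \<ominus>\<^bsub>tensor R (tensor R C C) C\<^esub> tensor_swap R C (tensor R C C) ?Y"
    using tensor_swap_natural[OF idC \<Delta> \<Delta>c] coassoc[OF c]
    by (simp add: alternation_def mod_homD(7)[OF \<Delta>i \<Delta>c s\<Delta>c])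
  ultimately have "alternation_left R C C ?R = alternation_left R C C ?L"
    using alternation_assoc_cyclic[OF C Y] by simp
  moreover have "?D c \<in> carrier (tensor R C C)"
    unfolding Dc by (rule Qu)
  ultimately show ?thesis
    unfolding coassociator_def
    using mod_homD(3)[OF alt3] mod_homD(3)[OF QQi] mod_homD(3)[OF \<Delta>i u]
    by (simp add: mod_homD(7)[OF alt3] left right mod_homD(3)[OF tensor_map_hom[OF D idC]]
        mod_homD(3)[OF assoc] mod_homD(3)[OF tensor_map_hom[OF idC D]])
qed

section \<open>The pre-Lie identity of the comodule\<close>

context
  fixes M and \<rho> and T
  assumes \<rho>: "mod_hom R M (tensor R C M) \<rho>" and T: "mod_hom R M M T"
begin

private lemma M: "module R M"
  by (rule mod_homD(1)[OF T])

private lemma idM: "mod_hom R M M id"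
  by (rule mod_hom_id[OF M])

private lemmas QiM = tensor_map_hom[OF Q idM] and iT = tensor_map_hom[OF idC T]
  and QT = tensor_map_hom[OF Q T]

lemma tilde_coaction_cong:
  "m \<in> carrier M \<Longrightarrow> tilde_coaction R C M \<rho> Q T m =
    tensor_map R C M C M Q id (\<rho> m) \<oplus>\<^bsub>tensor R C M\<^esub> tensor_map R C M C M id T (\<rho> m)"
  by (rule tilde_coaction_eq[OF Q T]) (rule mod_homD(3)[OF \<rho>])

lemma tilde_coaction_hom: "mod_hom R M (tensor R C M) (tilde_coaction R C M \<rho> Q T)"
  by (rule mod_hom_cong[OF mod_hom_plus[OF mod_hom_comp[OF \<rho> QiM] mod_hom_comp[OF \<rho> iT]]
        tilde_coaction_cong])

lemma alternation_comodule_associator: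
  assumes coassoc: "\<And>m. m \<in> carrier M \<Longrightarrow>
      tensor_map R C M (tensor R C C) M \<Delta> id (\<rho> m) =
      tensor_assoc R C C M (tensor_map R C M C (tensor R C M) id \<rho> (\<rho> m))"
    and rota_baxter_paired: "\<And>m. m \<in> carrier M \<Longrightarrow> tensor_map R C M C M Q T (\<rho> m) =
      tensor_map R C M C M Q id (\<rho> (T m)) \<oplus>\<^bsub>tensor R C M\<^esub>
      tensor_map R C M C M id T (\<rho> (T m))"
    and m: "m \<in> carrier M"
  shows "alternation_left R C M
      (comodule_associator R C (tilde_coproduct R C \<Delta> Q) M (tilde_coaction R C M \<rho> Q T) m) =
    \<zero>\<^bsub>tensor R (tensor R C C) M\<^esub>"
proof -
  let ?D = "tilde_coproduct R C \<Delta> Q" and ?r = "tilde_coaction R C M \<rho> Q T"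
  let ?CM = "tensor R C M" and ?CCM = "tensor R (tensor R C C) M"
    and ?CCM' = "tensor R C (tensor R C M)"
  let ?y = "\<rho> m"
  let ?w = "tensor_map R C M C (tensor R C M) id \<rho> ?y"
  let ?X = "tensor_map R C M (tensor R C C) M \<Delta> id ?y"
  let ?QQi = "tensor_map R (tensor R C C) M (tensor R C C) M (tensor_map R C C C C Q Q) id ?X"
  let ?QiT = "tensor_map R (tensor R C C) M (tensor R C C) M (tensor_map R C C C C Q id) T ?X"
  let ?iQT = "tensor_map R (tensor R C C) M (tensor R C C) M (tensor_map R C C C C id Q) T ?X"
  let ?Qy = "tensor_map R C M C M Q id ?y" and ?Ty = "tensor_map R C M C M id T ?y"
  let ?a = "tensor_assoc R C C M" and ?alt = "alternation_left R C M"
  note D = tilde_coproduct_hom and r = tilde_coaction_hom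
  note CC = tensor_module[OF C C] and CM = tensor_module[OF C M]
  note assoc = tensor_assoc_hom[OF C C M] and alt3 = alternation_left_hom[OF C M]
    and ir = tensor_map_hom[OF idC r] and Di = tensor_map_hom[OF D idM]
  interpret CCM: module R ?CCM by (rule tensor_module[OF CC M])
  have y: "?y \<in> carrier ?CM"
    by (rule mod_homD(3)[OF \<rho> m])
  have w: "?w \<in> carrier ?CCM'"
    by (rule mod_homD(3)[OF tensor_map_hom[OF idC \<rho>] y])
  have X: "?X \<in> carrier ?CCM"
    by (rule mod_homD(3)[OF tensor_map_hom[OF \<Delta> idM] y])
  have aw: "?a ?w = ?X"
    using coassoc[OF m] by simp
  have closed: "?QQi \<in> carrier ?CCM" "?QiT \<in> carrier ?CCM" "?iQT \<in> carrier ?CCM"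
    "?Qy \<in> carrier ?CM" "?Ty \<in> carrier ?CM"
    by (rule mod_homD(3)[OF tensor_map_hom[OF QQ idM] X]
        mod_homD(3)[OF tensor_map_hom[OF Qi T] X] mod_homD(3)[OF tensor_map_hom[OF iQ T] X]
        mod_homD(3)[OF QiM y] mod_homD(3)[OF iT y])+
  have rm: "?r m = ?Qy \<oplus>\<^bsub>?CM\<^esub> ?Ty"
    by (rule tilde_coaction_cong[OF m])

  let ?H = "\<lambda>z. tensor_map R C M C M Q id z \<oplus>\<^bsub>?CM\<^esub> tensor_map R C M C M id T z"
  note H = mod_hom_plus[OF QiM iT]
  \<comment> \<open>In the term with \<open>Q\<close> on the first slot, the inner coaction is
    expanded by its definition: its \<open>Q\<close> gives \<open>Q \<otimes> Q \<otimes> id\<close>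
    and its \<open>T\<close> gives \<open>Q \<otimes> id \<otimes> T\<close>.\<close>
  have "tensor_map R C M C ?CM id ?r ?Qy = tensor_map R C M C ?CM Q ?r ?y"
    using tensor_map_comp[OF Q idM idC r y] by (simp add: id_def)
  also have "\<dots> = tensor_map R C M C ?CM Q (\<lambda>n. ?H (\<rho> n)) ?y"
    by (rule tensor_map_cong[OF Q r Q mod_hom_comp[OF \<rho> H] refl tilde_coaction_cong y])
  also have "\<dots> = tensor_map R C ?CM C ?CM Q ?H ?w"
    using tensor_map_comp[OF idC \<rho> Q H y] by (simp add: id_def)
  also have "\<dots> = tensor_map R C ?CM C ?CM Q (tensor_map R C M C M Q id) ?w \<oplus>\<^bsub>?CCM'\<^esub>
      tensor_map R C ?CM C ?CM Q (tensor_map R C M C M id T) ?w"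
    by (rule tensor_map_add_right[OF Q QiM iT w])
  finally have A1: "?a (tensor_map R C M C ?CM id ?r ?Qy) = ?QQi \<oplus>\<^bsub>?CCM\<^esub> ?QiT"
    using tensor_assoc_natural[OF Q Q idM w] tensor_assoc_natural[OF Q idC T w]
    by (simp add: aw mod_homD(4)[OF assoc] mod_homD(3)[OF tensor_map_hom[OF Q QiM] w]
        mod_homD(3)[OF tensor_map_hom[OF Q iT] w])

  \<comment> \<open>In the term with \<open>T\<close>, the inner coaction is evaluated at
    \<open>T n\<close>, where its two summands are the right side of the paired identity and merge
    into \<open>(Q \<otimes> T) \<rho>\<close>. This is exact, without alternation.\<close>
  have "tensor_map R C M C ?CM id ?r ?Ty = tensor_map R C M C ?CM id (\<lambda>n. ?r (T n)) ?y"
    using tensor_map_comp[OF idC T idC r y] by (simp add: id_def)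
  also have "\<dots> = tensor_map R C M C ?CM id (\<lambda>n. tensor_map R C M C M Q T (\<rho> n)) ?y"
    by (rule tensor_map_cong[OF idC mod_hom_comp[OF T r] idC mod_hom_comp[OF \<rho> QT] refl _ y])
      (simp add: tilde_coaction_cong mod_homD(3)[OF T] rota_baxter_paired)
  also have "\<dots> = tensor_map R C ?CM C ?CM id (tensor_map R C M C M Q T) ?w"
    using tensor_map_comp[OF idC \<rho> idC QT y] by (simp add: id_def)
  finally have A2: "?a (tensor_map R C M C ?CM id ?r ?Ty) = ?iQT"
    using tensor_assoc_natural[OF idC Q T w] by (simp add: aw)

  \<comment> \<open>The coproduct meets \<open>Q\<close> on the first slot, so the Rota-Baxter
    identity of the coalgebra applies, but only under alternation.\<close>
  have "?alt (tensor_map R C M (tensor R C C) M ?D id ?Qy) =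
      ?alt (tensor_map R C M (tensor R C C) M (\<lambda>c. ?D (Q c)) id ?y)"
    using tensor_map_comp[OF Q idM D idM y] by (simp add: id_def)
  also have "\<dots> = ?alt (tensor_map R C M (tensor R C C) M
      (\<lambda>c. tensor_map R C C C C Q Q (\<Delta> c)) id ?y)"
    by (rule alternation_left_map_cong[OF mod_hom_comp[OF Q D] mod_hom_comp[OF \<Delta> QQ] idM C
          alternation_tilde_coproduct_operator y])
  also have "\<dots> = ?alt ?QQi"
    using tensor_map_comp[OF \<Delta> idM QQ idM y] by (simp add: id_def)
  finally have B1: "?alt (tensor_map R C M (tensor R C C) M ?D id ?Qy) = ?alt ?QQi" .

  let ?G = "\<lambda>z. tensor_map R C C C C Q id z \<oplus>\<^bsub>tensor R C C\<^esub> tensor_map R C C C C id Q z"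
  note G = mod_hom_plus[OF Qi iQ]
  \<comment> \<open>Here \<open>T\<close> acts on the last slot and the coproduct on a bare first
    slot. The alternated formula for \<open>\<Delta>~\<close> supplies both
    \<open>(Q \<otimes> id) \<otimes> T\<close> and \<open>(id \<otimes> Q) \<otimes> T\<close>, the
    terms that the other side collects from two different sources.\<close>
  have "?alt (tensor_map R C M (tensor R C C) M ?D id ?Ty) =
      ?alt (tensor_map R C M (tensor R C C) M ?D T ?y)"
    using tensor_map_comp[OF idC T D idM y] by (simp add: id_def)
  also have "\<dots> = ?alt (tensor_map R C M (tensor R C C) M (\<lambda>c. ?G (\<Delta> c)) T ?y)"
    by (rule alternation_left_map_cong[OF D mod_hom_comp[OF \<Delta> G] T C
          alternation_tilde_coproduct y])
  also have "\<dots> = ?alt (tensor_map R (tensor R C C) M (tensor R C C) M ?G T ?X)"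
    using tensor_map_comp[OF \<Delta> idM G T y] by (simp add: id_def)
  also have "\<dots> = ?alt (?QiT \<oplus>\<^bsub>?CCM\<^esub> ?iQT)"
    by (simp only: tensor_map_add_left[OF Qi iQ T X])
  finally have B2: "?alt (tensor_map R C M (tensor R C C) M ?D id ?Ty) =
      ?alt (?QiT \<oplus>\<^bsub>?CCM\<^esub> ?iQT)" .

  \<comment> \<open>Both iterations now consist of the same three terms, grouped as two plus one on
    this side and as one plus two on the other.\<close>
  have "?a (tensor_map R C M C ?CM id ?r (?r m)) = (?QQi \<oplus>\<^bsub>?CCM\<^esub> ?QiT) \<oplus>\<^bsub>?CCM\<^esub> ?iQT"
    using A1 A2 closed by (simp add: rm mod_homD(4)[OF ir] mod_homD(4)[OF assoc] mod_homD(3)[OF ir])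
  then have "?alt (?a (tensor_map R C M C ?CM id ?r (?r m))) =
      ?alt ?QQi \<oplus>\<^bsub>?CCM\<^esub> (?alt ?QiT \<oplus>\<^bsub>?CCM\<^esub> ?alt ?iQT)"
    using closed by (simp add: mod_homD(3,4)[OF alt3] CCM.a_assoc)
  also have "\<dots> = ?alt (tensor_map R C M (tensor R C C) M ?D id (?r m))"
    using B1 B2 closed by (simp add: rm mod_homD(4)[OF Di] mod_homD(4)[OF alt3] mod_homD(3)[OF Di])
  finally show ?thesis
    unfolding comodule_associator_def using mod_homD(3)[OF r m]
    by (simp add: mod_homD(7)[OF alt3] mod_homD(3)[OF alt3] mod_homD(3)[OF assoc]
        mod_homD(3)[OF ir] mod_homD(3)[OF Di])
qed

end

end

end

end

theorem proposition5p6: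
  fixes K :: "('k, 'r) ring_scheme"
    and C :: "('k, 'c, 'x) module_scheme"
    and M :: "('k, 'm, 'y) module_scheme"
    and \<Delta> :: "'c \<Rightarrow> ('c \<times> 'c \<Rightarrow> 'k) set"
    and \<rho> :: "'m \<Rightarrow> ('c \<times> 'm \<Rightarrow> 'k) set"
    and Q :: "'c \<Rightarrow> 'c"
    and T :: "'m \<Rightarrow> 'm"
  assumes "field K"
    and "rota_baxter_coalgebra K \<zero>\<^bsub>K\<^esub> C \<Delta> Q"
    and "rota_baxter_paired_comodule K \<zero>\<^bsub>K\<^esub> C \<Delta> M \<rho> Q T"
  shows "left_pre_lie_comodule K C (tilde_coproduct K C \<Delta> Q) M (tilde_coaction K C M \<rho> Q T)"
proof -
  interpret K: field K by fact
  note coalg = assms(2)[unfolded rota_baxter_coalgebra_def rota_baxter_coalgebra_axioms_def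
      coalgebra_def]
  note comod = assms(3)[unfolded rota_baxter_paired_comodule_def
      rota_baxter_paired_comodule_axioms_def left_comodule_def left_comodule_axioms_def]
  have \<Delta>: "mod_hom K C (tensor K C C) \<Delta>" and Q: "mod_hom K C C Q"
    and \<rho>: "mod_hom K M (tensor K C M) \<rho>" and T: "mod_hom K M M T"
    using coalg comod by (simp_all add: linear_map_def)
  note C = mod_homD(1)[OF Q] and M = mod_homD(1)[OF T]
  interpret CC: module K "tensor K C C" by (rule K.tensor_module[OF C C])
  interpret CM: module K "tensor K C M" by (rule K.tensor_module[OF C M])
  \<comment> \<open>The development works with \<open>mod_hom\<close> over a commutative ring. As
    \<open>K\<close> is a field, its modules are vector spaces, which gives back
    \<open>linear_map\<close>.\<close>
  have linear: "linear_map K V W f" if "mod_hom K V W f" for V W f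
    using that mod_homD(1,2)[OF that] assms(1) by (simp add: linear_map_def vectorspace_def)
  have coassoc: "tensor_map K C C (tensor K C C) C \<Delta> id (\<Delta> c) =
      tensor_assoc K C C C (tensor_map K C C C (tensor K C C) id \<Delta> (\<Delta> c))"
    if "c \<in> carrier C" for c
    using coalg that by blast
  have coaction_coassoc: "tensor_map K C M (tensor K C C) M \<Delta> id (\<rho> m) =
      tensor_assoc K C C M (tensor_map K C M C (tensor K C M) id \<rho> (\<rho> m))"
    if "m \<in> carrier M" for m
    using comod that by blast
  \<comment> \<open>The weight term is a zero multiple of \<open>\<Delta> (Q c)\<close>; the closure
    facts allow it to be dropped from the sum.\<close>
  have rb: "tensor_map K C C C C Q Q (\<Delta> c) = tensor_map K C C C C Q id (\<Delta> (Q c))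
      \<oplus>\<^bsub>tensor K C C\<^esub> tensor_map K C C C C id Q (\<Delta> (Q c))" if c: "c \<in> carrier C" for c
  proof -
    note z = mod_homD(3)[OF \<Delta> mod_homD(3)[OF Q c]] and id = mod_hom_id[OF C]
    show ?thesis
      using coalg c mod_homD(3)[OF K.tensor_map_hom[OF Q id] z]
        mod_homD(3)[OF K.tensor_map_hom[OF id Q] z] z by simp
  qed
  have rb_paired: "tensor_map K C M C M Q T (\<rho> m) = tensor_map K C M C M Q id (\<rho> (T m))
      \<oplus>\<^bsub>tensor K C M\<^esub> tensor_map K C M C M id T (\<rho> (T m))" if m: "m \<in> carrier M" for m
  proof -
    note z = mod_homD(3)[OF \<rho> mod_homD(3)[OF T m]]
    show ?thesis
      using comod m mod_homD(3)[OF K.tensor_map_hom[OF Q mod_hom_id[OF M]] z]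
        mod_homD(3)[OF K.tensor_map_hom[OF mod_hom_id[OF C] T] z] z by simp
  qed
  \<comment> \<open>The target locale extends \<open>pre_lie_coalgebra\<close>, so the pre-Lie law
    of the new coproduct is established along with that of the coaction. Both laws are
    \<open>alternation_left\<close> of an associator, unfolded.\<close>
  show ?thesis
    unfolding left_pre_lie_comodule_def left_pre_lie_comodule_axioms_def pre_lie_coalgebra_def
    using K.alternation_coassociator[OF \<Delta> Q rb coassoc]
      K.alternation_comodule_associator[OF \<Delta> Q rb \<rho> T coaction_coassoc rb_paired]
      linear[OF K.tilde_coproduct_hom[OF \<Delta> Q]] linear[OF K.tilde_coaction_hom[OF \<Delta> Q rb \<rho> T]]
    by (simp add: alternation_left_def)
qed

end
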